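(* Let $n,d,m,N,K$ be positive integers. Let $x_1,\dots,x_n\in\mathbb{R}^d$ with $\|x_i\|_2=1$ for all $i$, and labels $y_1,\dots,y_n\in\mathbb{R}$ with $|y_i|=O(1)$; write $y=(y_1,\dots,y_n)\in\mathbb{R}^n$. Let $S_1,\dots,S_N$ be a partition of $[n]$ into pairwise disjoint sets. Initialize $u_r(0)\sim\mathcal{N}(0,I_d)$ i.i.d. for $r\in[m]$ and $a_r$ i.i.d. uniform on $\{-1,+1\}$ (independent of the $u_r(0)$), and run the federated learning algorithm described in the context. Let $H(0)\in\mathbb{R}^{n\times n}$ be given by $H(0)_{i,j}=\frac1m\sum_{r=1}^m x_i^\top x_j\mathbf{1}_{u_r(0)^\top x_i\ge 0,\,u_r(0)^\top x_j\ge 0}$, let $\lambda=\lambda_{\min}(H(0))$ and assume $\lambda\in(0,1]$, and let $\kappa$ be the condition number of $H(0)$. Suppose $m=\Omega(\lambda^{-4}n^4\log(n/\delta))$, $\eta_{\mathrm{local}}=O(\lambda/(\kappa K n^2))$ and $\eta_{\mathrm{global}}=O(1)$. Then with probability at least $1-\delta$ over the random initialization, for all $t=0,1,2,\dots$, \[ \|y(t)-y\|_2^2\le\Big(1-\frac{\eta_{\mathrm{global}}\eta_{\mathrm{local}}\lambda K}{2N}\Big)^t\|y(0)-y\|_2^2 . \]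
   Context: $\phi(z)=\max\{z,0\}$ is the ReLU. For $u=(u_1,\dots,u_m)\in\mathbb{R}^{d\times m}$ (columns $u_r\in\mathbb{R}^d$), the network is $f(u,x)=\frac{1}{\sqrt m}\sum_{r=1}^m a_r\phi(u_r^\top x)$; only the first layer $u$ is trained, $a$ stays fixed. Federated learning algorithm (FedAvg with $N$ clients, client $c$ holding data $\{(x_i,y_i):i\in S_c\}$): at each global round $t=0,1,2,\dots$, every client $c\in[N]$ sets $w_{0,c}(t)=u(t)$ and performs $K$ local gradient descent steps with step size $\eta_{\mathrm{local}}$ on the local loss $L_c(w)=\frac12\sum_{i\in S_c}(f(w,x_i)-y_i)^2$, i.e. for each $r\in[m]$, $w_{k,c,r}(t)=w_{k-1,c,r}(t)-\eta_{\mathrm{local}}\frac{1}{\sqrt m}\sum_{i\in S_c}(f(w_{k-1,c}(t),x_i)-y_i)a_r x_i\mathbf{1}_{w_{k-1,c,r}(t)^\top x_i\ge0}$, $k=1,\dots,K$. The server then sets $u(t+1)=u(t)+\eta_{\mathrm{global}}\cdot\frac1N\sum_{c\in[N]}(w_{K,c}(t)-u(t))$. The prediction vector is $y(t)\in\mathbb{R}^n$ with $y(t)_i=f(u(t),x_i)$. $O(\cdot),\Omega(\cdot)$ hide absolute constants (sufficiently large constant in $\Omega$, sufficiently small in the step-size bounds). *)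

theory Defs
  imports "HOL-Probability.Probability" "Jordan_Normal_Form.Char_Poly"
begin

text \<open>Vectors in R^d are represented as functions nat => real, only coordinates < d matter.
  Neurons r < m, data points i < n, clients c < N (0-based indices).\<close>

definition relu :: "real \<Rightarrow> real" where
  "relu z = max z 0"

definition dotp :: "nat \<Rightarrow> (nat \<Rightarrow> real) \<Rightarrow> (nat \<Rightarrow> real) \<Rightarrow> real" where
  "dotp d v w = (\<Sum>k<d. v k * w k)"

definition net :: "nat \<Rightarrow> nat \<Rightarrow> (nat \<Rightarrow> real) \<Rightarrow> (nat \<Rightarrow> nat \<Rightarrow> real) \<Rightarrow> (nat \<Rightarrow> real) \<Rightarrow> real" where
  "net d m a w x = (1 / sqrt (real m)) * (\<Sum>r<m. a r * relu (dotp d (w r) x))"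

definition local_step ::
  "nat \<Rightarrow> nat \<Rightarrow> (nat \<Rightarrow> real) \<Rightarrow> (nat \<Rightarrow> nat \<Rightarrow> real) \<Rightarrow> (nat \<Rightarrow> real) \<Rightarrow> nat set \<Rightarrow> real
    \<Rightarrow> (nat \<Rightarrow> nat \<Rightarrow> real) \<Rightarrow> (nat \<Rightarrow> nat \<Rightarrow> real)" where
  "local_step d m a x y Sc eta w = (\<lambda>r k. w r k - eta * (1 / sqrt (real m)) *
      (\<Sum>i\<in>Sc. (net d m a w (x i) - y i) * a r * x i k *
         (if dotp d (w r) (x i) \<ge> 0 then 1 else 0)))"

fun fedavg ::
  "nat \<Rightarrow> nat \<Rightarrow> nat \<Rightarrow> nat \<Rightarrow> (nat \<Rightarrow> real) \<Rightarrow> (nat \<Rightarrow> nat \<Rightarrow> real) \<Rightarrow> (nat \<Rightarrow> real)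
    \<Rightarrow> (nat \<Rightarrow> nat set) \<Rightarrow> real \<Rightarrow> real \<Rightarrow> (nat \<Rightarrow> nat \<Rightarrow> real) \<Rightarrow> nat \<Rightarrow> (nat \<Rightarrow> nat \<Rightarrow> real)" where
  "fedavg d m N K a x y S eta_l eta_g u0 0 = u0"
| "fedavg d m N K a x y S eta_l eta_g u0 (Suc t) =
     (let u = fedavg d m N K a x y S eta_l eta_g u0 t;
          wK = (\<lambda>c. (local_step d m a x y (S c) eta_l ^^ K) u)
      in (\<lambda>r k. u r k + eta_g * ((1 / real N) * (\<Sum>c<N. wK c r k - u r k))))"

definition pred_err :: "nat \<Rightarrow> nat \<Rightarrow> nat \<Rightarrow> (nat \<Rightarrow> real) \<Rightarrow> (nat \<Rightarrow> nat \<Rightarrow> real) \<Rightarrow> (nat \<Rightarrow> real)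
    \<Rightarrow> (nat \<Rightarrow> nat \<Rightarrow> real) \<Rightarrow> real" where
  "pred_err n d m a x y u = (\<Sum>i<n. (net d m a u (x i) - y i)\<^sup>2)"

definition H0 :: "nat \<Rightarrow> nat \<Rightarrow> nat \<Rightarrow> (nat \<Rightarrow> nat \<Rightarrow> real) \<Rightarrow> (nat \<Rightarrow> nat \<Rightarrow> real) \<Rightarrow> real mat" where
  "H0 n d m x u = mat n n (\<lambda>(i, j). (1 / real m) * (\<Sum>r<m. dotp d (x i) (x j) *
      (if dotp d (u r) (x i) \<ge> 0 \<and> dotp d (u r) (x j) \<ge> 0 then 1 else 0)))"

definition lambda_min :: "real mat \<Rightarrow> real" where
  "lambda_min A = Min {k. eigenvalue A k}"

definition cond_number :: "real mat \<Rightarrow> real" where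
  "cond_number A = Max (sqrt ` {k. eigenvalue (transpose_mat A * A) k})
                  / Min (sqrt ` {k. eigenvalue (transpose_mat A * A) k})"

definition std_gauss :: "real measure" where
  "std_gauss = density lborel (normal_density 0 1)"

definition rademacher :: "real measure" where
  "rademacher = measure_pmf (pmf_of_set {-1, 1})"

definition init_measure :: "nat \<Rightarrow> nat \<Rightarrow> ((nat \<Rightarrow> nat \<Rightarrow> real) \<times> (nat \<Rightarrow> real)) measure" where
  "init_measure d m = (PiM {..<m} (\<lambda>_. PiM {..<d} (\<lambda>_. std_gauss))) \<Otimes>\<^sub>M (PiM {..<m} (\<lambda>_. rademacher))"

end

theory Submission
  imports Defs
begin

text \<open>
  Let \<open>e\<close> be the vector of residuals. As long as every neuron stays within distance \<open>R\<close> of its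
  initial value, a neuron can change its activation on \<open>x\<^sub>i\<close> only if initially
  \<open>\<bar>u\<^sub>r \<bullet> x\<^sub>i\<bar> \<le> R\<close>. If at most \<open>q\<close> neurons do so for each \<open>i\<close>, one global round acts on \<open>e\<close> as
  \<open>e \<mapsto> e - \<alpha> H(0) e\<close> with \<open>\<alpha> = \<eta>\<^sub>g \<eta>\<^sub>l K / N\<close>, up to an error in each coordinate of at most
  \<open>\<alpha> \<parallel>e\<parallel>\<^sub>1 (6 q / m + 2 n \<eta>\<^sub>l K)\<close>. Hence \<open>\<parallel>e\<parallel>\<^sup>2\<close> contracts by \<open>1 - \<alpha> \<lambda> / 2\<close> per round, and summing
  the resulting geometric series shows that the neurons do stay within distance \<open>R\<close>.

  The data-dependent \<open>\<lambda>\<close> does not enter the good event: with \<open>L = ln (n / \<delta>)\<close> the deterministic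
  radius \<open>R = (L / m)\<^sup>1\<^sup>/\<^sup>4\<close> works, since the hypothesis on \<open>m\<close> says exactly that \<open>\<lambda>\<close> is at least a
  large multiple of \<open>n R\<close>. Chernoff bounds give \<open>q = 4 m R\<close> and \<open>\<bar>f(u(0), x\<^sub>i)\<bar> \<le> \<surd>(6 L)\<close>.

  This needs \<open>L\<close> bounded below, which fails only if \<open>n = 1\<close> and \<open>\<delta>\<close> is close to 1. Then the good
  event needs only the small probability \<open>1 - \<delta> \<le> L\<close>: either \<open>m\<close> is large, and the previous
  argument applies at confidence \<open>3 / 4\<close> since \<open>\<lambda> \<ge> 1 / 4\<close> is likely, or \<open>m\<close> is bounded, and the
  hypothesis on \<open>m\<close> either fails or makes \<open>1 - \<delta>\<close> at most \<open>2\<^sup>-\<^sup>m\<close>, the probability of \<open>\<lambda> = 0\<close>.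
\<close>

section \<open>Deterministic analysis of the iteration\<close>

lemma dotp_commute: "dotp d v w = dotp d w v"
  by (simp add: dotp_def mult.commute)

lemma dotp_diff_left: "dotp d (\<lambda>k. v k - v' k) w = dotp d v w - dotp d v' w"
  by (simp add: dotp_def left_diff_distrib sum_subtractf)

lemma dotp_scale_left: "dotp d (\<lambda>k. c * v k) w = c * dotp d v w"
  by (simp add: dotp_def sum_distrib_left mult.assoc)

lemma dotp_sum_left: "dotp d (\<lambda>k. \<Sum>i\<in>A. f i k) w = (\<Sum>i\<in>A. dotp d (f i) w)"
  unfolding dotp_def by (subst sum.swap) (simp add: sum_distrib_right)

lemma abs_dotp_le: "\<bar>dotp d v w\<bar> \<le> L2_set v {..<d} * L2_set w {..<d}"
proof -
  have "\<bar>dotp d v w\<bar> \<le> (\<Sum>k<d. \<bar>v k\<bar> * \<bar>w k\<bar>)"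
    unfolding dotp_def by (rule order_trans[OF sum_abs]) (simp add: abs_mult)
  also have "\<dots> \<le> L2_set v {..<d} * L2_set w {..<d}"
    by (rule L2_set_mult_ineq)
  finally show ?thesis .
qed

lemma L2_set_unit:
  assumes "dotp d v v = 1"
  shows "L2_set v {..<d} = 1"
  using assms by (simp add: L2_set_def dotp_def power2_eq_square)

lemma L2_set_scale: "L2_set (\<lambda>k. c * v k) A = \<bar>c\<bar> * L2_set v A"
  by (simp add: L2_set_def power_mult_distrib real_sqrt_mult flip: sum_distrib_left)

lemma L2_set_sum:
  assumes "finite I"
  shows "L2_set (\<lambda>k. \<Sum>i\<in>I. f i k) A \<le> (\<Sum>i\<in>I. L2_set (f i) A)"
  using assms
proof (induction I rule: finite_induct)
  case empty
  then show ?case by (simp add: L2_set_def)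
next
  case (insert j I)
  then show ?case
    using L2_set_triangle_ineq[of "f j" "\<lambda>k. \<Sum>i\<in>I. f i k" A] by simp
qed

text \<open>Cauchy-Schwarz against the constant vector 1. It links the l1 norm, in which the local
  steps are controlled, to the squared l2 norm that contracts.\<close>

lemma sum_abs_le_sqrt:
  fixes e :: "nat \<Rightarrow> real"
  shows "(\<Sum>i<n. \<bar>e i\<bar>) \<le> sqrt (real n) * sqrt (\<Sum>i<n. (e i)\<^sup>2)"
proof -
  have "(\<Sum>i<n. \<bar>1\<bar> * \<bar>e i\<bar>) \<le> L2_set (\<lambda>i. 1) {..<n} * L2_set e {..<n}"
    by (rule L2_set_mult_ineq)
  then show ?thesis by (simp add: L2_set_def)
qed

lemma relu_lipschitz: "\<bar>relu s - relu t\<bar> \<le> \<bar>s - t\<bar>"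
  by (auto simp: relu_def max_def)

lemma net_diff:
  "net d m a w v - net d m a w' v
    = (1 / sqrt (real m)) * (\<Sum>r<m. a r * (relu (dotp d (w r) v) - relu (dotp d (w' r) v)))"
  by (simp add: net_def right_diff_distrib sum_subtractf)

text \<open>The signs have modulus 1, ReLU is 1-Lipschitz and \<open>v\<close> is a unit vector, so
  each neuron contributes at most the length of its displacement.\<close>

lemma net_lipschitz:
  assumes a: "\<And>r. r < m \<Longrightarrow> \<bar>a r\<bar> = 1" and v: "L2_set v {..<d} = 1"
  shows "\<bar>net d m a w v - net d m a w' v\<bar>
    \<le> (1 / sqrt (real m)) * (\<Sum>r<m. L2_set (\<lambda>k. w r k - w' r k) {..<d})"
proof -
  have "\<bar>a r * (relu (dotp d (w r) v) - relu (dotp d (w' r) v))\<bar>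
      \<le> L2_set (\<lambda>k. w r k - w' r k) {..<d}" if "r < m" for r
  proof -
    have "\<bar>a r * (relu (dotp d (w r) v) - relu (dotp d (w' r) v))\<bar>
      \<le> \<bar>dotp d (\<lambda>k. w r k - w' r k) v\<bar>"
      using a[OF that] relu_lipschitz by (simp add: abs_mult dotp_diff_left)
    also have "\<dots> \<le> L2_set (\<lambda>k. w r k - w' r k) {..<d}"
      using abs_dotp_le[of d "\<lambda>k. w r k - w' r k" v] v by simp
    finally show ?thesis .
  qed
  then have "\<bar>\<Sum>r<m. a r * (relu (dotp d (w r) v) - relu (dotp d (w' r) v))\<bar>
      \<le> (\<Sum>r<m. L2_set (\<lambda>k. w r k - w' r k) {..<d})"
    by (intro order_trans[OF sum_abs] sum_mono) auto
  then show ?thesis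
    unfolding net_diff abs_mult by (intro mult_mono) auto
qed

section \<open>Local steps and global rounds without control of the activations\<close>

locale fedavg_run =
  fixes n d m N K :: nat and x :: "nat \<Rightarrow> nat \<Rightarrow> real" and y :: "nat \<Rightarrow> real"
    and S :: "nat \<Rightarrow> nat set" and \<eta>l \<eta>g :: real and a :: "nat \<Rightarrow> real"
  assumes n: "n \<ge> 1" and m: "m \<ge> 1" and N: "N \<ge> 1" and K: "K \<ge> 1"
    and x_unit: "\<And>i. i < n \<Longrightarrow> dotp d (x i) (x i) = 1"
    and S_disj: "\<And>c c'. c < N \<Longrightarrow> c' < N \<Longrightarrow> c \<noteq> c' \<Longrightarrow> S c \<inter> S c' = {}"
    and S_Un: "(\<Union>c<N. S c) = {..<n}"
    and \<eta>l: "0 < \<eta>l" and \<eta>g: "0 < \<eta>g" "\<eta>g \<le> 1"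
    and a: "\<And>r. r < m \<Longrightarrow> a r = 1 \<or> a r = -1"
    and \<eta>l_small: "\<eta>l * real K * real n \<le> 1 / 100"
begin

abbreviation "res w i \<equiv> net d m a w (x i) - y i"
abbreviation "act w r i \<equiv> (if dotp d (w r) (x i) \<ge> 0 then 1 else 0 :: real)"
abbreviation "nm v \<equiv> L2_set v {..<d}"
abbreviation "st c \<equiv> local_step d m a x y (S c) \<eta>l"
abbreviation "W c k u \<equiv> (st c ^^ k) u"
abbreviation "E1 c w \<equiv> (\<Sum>i\<in>S c. \<bar>res w i\<bar>)"
abbreviation "E w \<equiv> (\<Sum>i<n. \<bar>res w i\<bar>)"

definition \<alpha> where "\<alpha> = \<eta>g * \<eta>l * real K / real N"

lemma a_abs: "r < m \<Longrightarrow> \<bar>a r\<bar> = 1"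
  using a by fastforce

lemma x_norm: "i < n \<Longrightarrow> nm (x i) = 1"
  using x_unit by (simp add: L2_set_unit)

lemma S_sub: "c < N \<Longrightarrow> S c \<subseteq> {..<n}"
  using S_Un by blast

lemma S_fin: "c < N \<Longrightarrow> finite (S c)"
  using S_sub finite_subset by blast

lemma card_S: "c < N \<Longrightarrow> card (S c) \<le> n"
  using card_mono[OF _ S_sub] by fastforce

text \<open>As the clients partition the data, client-wise l1 norms add up to that of the whole
  residual; averaging over clients therefore leaves the factor 1 / N in
  \<open>\<alpha>\<close>.\<close>

lemma sum_S: "(\<Sum>c<N. \<Sum>i\<in>S c. f i) = (\<Sum>i<n. f i)"
proof -
  have "(\<Sum>i\<in>(\<Union>c<N. S c). f i) = (\<Sum>c<N. \<Sum>i\<in>S c. f i)"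
    by (rule sum.UNION_disjoint) (use S_disj S_fin in auto)
  then show ?thesis using S_Un by simp
qed

lemma norm_gradient_term:
  assumes "r < m" "i < n" "\<bar>b\<bar> \<le> 1"
  shows "nm (\<lambda>k. e * a r * x i k * b) \<le> \<bar>e\<bar>"
proof -
  have "nm (\<lambda>k. e * a r * x i k * b) = nm (\<lambda>k. (e * a r * b) * x i k)"
    by (simp add: mult.commute mult.left_commute)
  also have "\<dots> = \<bar>e\<bar> * \<bar>b\<bar>"
    unfolding L2_set_scale using assms by (simp add: x_norm abs_mult a_abs)
  also have "\<dots> \<le> \<bar>e\<bar>"
    using assms by (simp add: mult_left_le)
  finally show ?thesis .
qed

lemma norm_local_step:
  assumes c: "c < N" and r: "r < m"
  shows "nm (\<lambda>k. st c w r k - w r k) \<le> \<eta>l / sqrt (real m) * E1 c w"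
proof -
  have "(\<lambda>k. st c w r k - w r k) = (\<lambda>k. (- (\<eta>l / sqrt (real m))) *
      (\<Sum>i\<in>S c. res w i * a r * x i k * act w r i))"
    by (simp add: local_step_def)
  then have "nm (\<lambda>k. st c w r k - w r k) = \<eta>l / sqrt (real m) *
      nm (\<lambda>k. \<Sum>i\<in>S c. res w i * a r * x i k * act w r i)"
    unfolding L2_set_scale using \<eta>l
    by (simp only: L2_set_scale) simp
  also have "\<dots> \<le> \<eta>l / sqrt (real m) * E1 c w"
  proof (intro mult_left_mono order_trans[OF L2_set_sum] sum_mono)
    fix i assume "i \<in> S c"
    then have "i < n" using S_sub[OF c] by auto
    then show "nm (\<lambda>k. res w i * a r * x i k * act w r i) \<le> \<bar>res w i\<bar>"
      by (intro norm_gradient_term r) auto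
  qed (use \<eta>l S_fin[OF c] in auto)
  finally show ?thesis .
qed

text \<open>The scaling at which the number m of neurons cancels against two factors 1 / sqrt m, one
  from the network and one from the displacement.\<close>

lemma res_diff_le:
  assumes i: "i < n" and D: "\<And>r. r < m \<Longrightarrow> nm (\<lambda>k. w r k - w' r k) \<le> D / sqrt (real m)"
  shows "\<bar>res w i - res w' i\<bar> \<le> D"
proof -
  have "\<bar>res w i - res w' i\<bar> \<le> (1 / sqrt (real m)) * (\<Sum>r<m. nm (\<lambda>k. w r k - w' r k))"
    using net_lipschitz[OF a_abs x_norm[OF i], where w = w and w' = w'] by simp
  also have "\<dots> \<le> (1 / sqrt (real m)) * (\<Sum>r<m. D / sqrt (real m))"
    by (intro mult_left_mono sum_mono) (use D in auto)
  also have "\<dots> = D"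
    using m by (simp add: field_simps)
  finally show ?thesis .
qed

lemma res_local_step:
  assumes c: "c < N" and i: "i < n"
  shows "\<bar>res (st c w) i - res w i\<bar> \<le> \<eta>l * E1 c w"
  using norm_local_step[OF c, where w = w] by (intro res_diff_le[OF i]) (simp add: field_simps)

text \<open>Each of the at most n residuals of the client moves by at most \<open>\<eta>l\<close>
  times their l1 norm. This is a crude growth bound, not a descent estimate, so it holds for
  arbitrary activations.\<close>

lemma E1_local_step:
  assumes c: "c < N"
  shows "E1 c (st c w) \<le> (1 + \<eta>l * real n) * E1 c w"
proof -
  have "E1 c (st c w) \<le> (\<Sum>i\<in>S c. \<bar>res w i\<bar> + \<eta>l * E1 c w)"
  proof (rule sum_mono)
    fix i assume "i \<in> S c"
    then have "i < n" using S_sub[OF c] by auto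
    from res_local_step[OF c this, of w]
    show "\<bar>res (st c w) i\<bar> \<le> \<bar>res w i\<bar> + \<eta>l * E1 c w" by linarith
  qed
  also have "\<dots> = E1 c w + real (card (S c)) * (\<eta>l * E1 c w)"
    by (simp add: sum.distrib)
  also have "\<dots> \<le> E1 c w + real n * (\<eta>l * E1 c w)"
    using card_S[OF c] \<eta>l by (intro add_left_mono mult_right_mono) (auto intro!: mult_nonneg_nonneg sum_nonneg)
  finally show ?thesis by (simp add: algebra_simps)
qed

text \<open>The growth factor compounds to at most exp (\<open>\<eta>l * K * n\<close>), which stays
  below 2 by \<open>\<eta>l_small\<close>.\<close>

lemma E1_iterate:
  assumes c: "c < N" and k: "k \<le> K"
  shows "E1 c (W c k u) \<le> 2 * E1 c u"
proof -
  have "E1 c (W c k u) \<le> (1 + \<eta>l * real n) ^ k * E1 c u" for k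
  proof (induction k)
    case (Suc k)
    have "E1 c (W c (Suc k) u) \<le> (1 + \<eta>l * real n) * E1 c (W c k u)"
      using E1_local_step[OF c, of "W c k u"] by simp
    also have "\<dots> \<le> (1 + \<eta>l * real n) * ((1 + \<eta>l * real n) ^ k * E1 c u)"
      using Suc \<eta>l by (intro mult_left_mono) auto
    finally show ?case by (simp add: mult.assoc)
  qed simp
  also have "(1 + \<eta>l * real n) ^ k * E1 c u \<le> 2 * E1 c u"
  proof (intro mult_right_mono)
    have "(1 + \<eta>l * real n) ^ k \<le> (1 + \<eta>l * real n) ^ K"
      using \<eta>l k by (intro power_increasing) auto
    also have "\<dots> \<le> exp (\<eta>l * real n) ^ K"
      using \<eta>l by (intro power_mono) (auto simp: exp_ge_add_one_self)
    also have "\<dots> = exp (\<eta>l * real K * real n)"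
      by (simp add: exp_of_nat_mult[symmetric] mult.commute mult.left_commute)
    also have "\<dots> \<le> exp (1 / 100)"
      using \<eta>l_small by simp
    also have "\<dots> \<le> (2 :: real)"
      using exp_bound[of "1 / 100 :: real"] by (simp add: power2_eq_square)
    finally show "(1 + \<eta>l * real n) ^ k \<le> 2" .
  qed (auto intro: sum_nonneg)
  finally show ?thesis .
qed

text \<open>Every step moves a neuron by at most \<open>\<eta>l / sqrt m\<close> times the current
  l1 residual, which never exceeds twice the one at \<open>u\<close>.\<close>

lemma norm_iterate:
  assumes c: "c < N" and r: "r < m" and k: "k \<le> K"
  shows "nm (\<lambda>j. W c k u r j - u r j) \<le> 2 * \<eta>l * real K * E1 c u / sqrt (real m)"
proof -
  have "nm (\<lambda>j. W c k u r j - u r j) \<le> real k * (2 * \<eta>l * E1 c u / sqrt (real m))"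
    using k
  proof (induction k)
    case (Suc k)
    have "nm (\<lambda>j. W c (Suc k) u r j - u r j)
        = nm (\<lambda>j. (st c (W c k u) r j - W c k u r j) + (W c k u r j - u r j))"
      by simp
    also have "\<dots> \<le> nm (\<lambda>j. st c (W c k u) r j - W c k u r j) + nm (\<lambda>j. W c k u r j - u r j)"
      by (rule L2_set_triangle_ineq)
    also have "\<dots> \<le> \<eta>l / sqrt (real m) * (2 * E1 c u) + real k * (2 * \<eta>l * E1 c u / sqrt (real m))"
    proof (rule add_mono)
      show "nm (\<lambda>j. st c (W c k u) r j - W c k u r j) \<le> \<eta>l / sqrt (real m) * (2 * E1 c u)"
        using E1_iterate[OF c, of k u] Suc.prems \<eta>l
        by (intro order_trans[OF norm_local_step[OF c r]] mult_left_mono) auto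
    qed (use Suc in auto)
    finally show ?case by (simp add: algebra_simps add_divide_distrib)
  qed (simp add: L2_set_def)
  also have "\<dots> \<le> real K * (2 * \<eta>l * E1 c u / sqrt (real m))"
    using k \<eta>l by (intro mult_right_mono) (auto intro!: mult_nonneg_nonneg divide_nonneg_nonneg sum_nonneg)
  also have "\<dots> = 2 * \<eta>l * real K * E1 c u / sqrt (real m)"
    by simp
  finally show ?thesis .
qed

lemma res_iterate:
  assumes c: "c < N" and i: "i < n" and k: "k \<le> K"
  shows "\<bar>res (W c k u) i - res u i\<bar> \<le> 2 * \<eta>l * real K * E1 c u"
  using norm_iterate[OF c _ k, of _ u] by (intro res_diff_le[OF i]) auto

lemma E1_le: "c < N \<Longrightarrow> E1 c u \<le> E u"
  by (intro sum_mono2) (use S_sub in auto)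

definition upd where
  "upd u = (\<lambda>r k. u r k + \<eta>g * ((1 / real N) * (\<Sum>c<N. W c K u r k - u r k)))"

lemma fedavg_Suc:
  "fedavg d m N K a x y S \<eta>l \<eta>g u0 (Suc t) = upd (fedavg d m N K a x y S \<eta>l \<eta>g u0 t)"
  by (simp add: upd_def Let_def)

text \<open>Summing the local displacements over the partition turns the \<open>E1 c u\<close> into
  \<open>E u\<close>, so a whole round moves a neuron in proportion to \<open>\<alpha>\<close>
  rather than to \<open>\<eta>l * K\<close>. This gain is what makes the displacements of all rounds
  summable against the contraction rate.\<close>

lemma norm_upd:
  assumes r: "r < m"
  shows "nm (\<lambda>j. upd u r j - u r j) \<le> 2 * \<alpha> * E u / sqrt (real m)"
proof -
  have "nm (\<lambda>j. upd u r j - u r j) = nm (\<lambda>j. (\<eta>g / real N) * (\<Sum>c<N. W c K u r j - u r j))"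
    by (simp add: upd_def)
  also have "\<dots> = (\<eta>g / real N) * nm (\<lambda>j. \<Sum>c<N. W c K u r j - u r j)"
    unfolding L2_set_scale using \<eta>g by simp
  also have "\<dots> \<le> (\<eta>g / real N) * (\<Sum>c<N. 2 * \<eta>l * real K * E1 c u / sqrt (real m))"
    using \<eta>g by (intro mult_left_mono order_trans[OF L2_set_sum] sum_mono norm_iterate r) auto
  also have "\<dots> = (\<eta>g / real N) * (\<Sum>c<N. 2 * \<eta>l * real K / sqrt (real m) * E1 c u)"
    by simp
  also have "\<dots> = (\<eta>g / real N) * (2 * \<eta>l * real K / sqrt (real m) * (\<Sum>c<N. E1 c u))"
    by (subst sum_distrib_left[symmetric]) (rule refl)
  also have "\<dots> = 2 * \<alpha> * E u / sqrt (real m)"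
    unfolding sum_S by (simp add: \<alpha>_def)
  finally show ?thesis .
qed

lemma \<alpha>_pos: "\<alpha> > 0"
  using \<eta>l \<eta>g K N by (simp add: \<alpha>_def)

lemma \<alpha>_le: "\<alpha> \<le> \<eta>l * real K"
proof -
  have "\<eta>g / real N \<le> 1"
    using \<eta>g N by (simp add: divide_le_eq)
  then have "(\<eta>g / real N) * (\<eta>l * real K) \<le> 1 * (\<eta>l * real K)"
    using \<eta>l by (intro mult_right_mono) auto
  then show ?thesis by (simp add: \<alpha>_def mult.assoc)
qed

lemma iterate_eq:
  "W c k u r j - u r j = - (\<eta>l / sqrt (real m)) *
     (\<Sum>k'<k. \<Sum>i\<in>S c. res (W c k' u) i * a r * x i j * act (W c k' u) r i)"
proof (induction k)
  case (Suc k)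
  have "W c (Suc k) u r j - u r j = (st c (W c k u) r j - W c k u r j) + (W c k u r j - u r j)"
    by simp
  also have "st c (W c k u) r j - W c k u r j
      = - (\<eta>l / sqrt (real m)) * (\<Sum>i\<in>S c. res (W c k u) i * a r * x i j * act (W c k u) r i)"
    by (simp add: local_step_def)
  finally show ?case unfolding Suc by (simp add: algebra_simps)
qed simp

lemma upd_eq:
  "upd u r j - u r j = - (\<eta>g * \<eta>l / (real N * sqrt (real m))) *
     (\<Sum>c<N. \<Sum>k<K. \<Sum>i\<in>S c. res (W c k u) i * a r * x i j * act (W c k u) r i)"
  unfolding upd_def iterate_eq by (simp only: sum_distrib_left[symmetric]) simp

lemma dotp_upd:
  "dotp d (\<lambda>j. upd u r j - u r j) v = - (\<eta>g * \<eta>l / (real N * sqrt (real m))) *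
     (\<Sum>c<N. \<Sum>k<K. \<Sum>i\<in>S c. res (W c k u) i * a r * act (W c k u) r i * dotp d (x i) v)"
proof -
  have "(\<lambda>j. res (W c k u) i * a r * x i j * act (W c k u) r i)
      = (\<lambda>j. (res (W c k u) i * a r * act (W c k u) r i) * x i j)" for c k i
    by (simp add: mult.commute mult.left_commute)
  note eq = this
  show ?thesis
    unfolding upd_eq dotp_scale_left dotp_sum_left eq by simp
qed

end

text \<open>The good event in deterministic form: \<open>q\<close> bounds, for each data point, the
  neurons that can flip while all weights stay within \<open>R\<close>. \<open>q_small\<close> and
  \<open>\<eta>l_lam\<close> keep the perturbations of a round below the gap \<open>lam\<close>, and
  \<open>coercive\<close> is the Rayleigh bound for H(0) written out in coordinates.\<close>

locale fedavg_stable = fedavg_run +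
  fixes u0 :: "nat \<Rightarrow> nat \<Rightarrow> real" and R q lam :: real
  assumes few_unstable: "\<And>i. i < n \<Longrightarrow> real (card {r. r < m \<and> \<bar>dotp d (u0 r) (x i)\<bar> \<le> R}) \<le> q"
    and lam: "0 < lam" "lam \<le> 1"
    and q_small: "12 * real n * q \<le> lam * real m"
    and \<eta>l_lam: "\<eta>l * real K * (real n)\<^sup>2 \<le> lam / 100"
    and coercive: "\<And>v. lam * (\<Sum>i<n. (v i)\<^sup>2) \<le>
      (\<Sum>i<n. v i * (\<Sum>j<n. (1 / real m) * (\<Sum>r<m. dotp d (x i) (x j) *
         (if dotp d (u0 r) (x i) \<ge> 0 \<and> dotp d (u0 r) (x j) \<ge> 0 then 1 else 0)) * v j))"
begin

section \<open>One round within distance \<open>R\<close> of the initialization\<close>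

abbreviation "unstable i \<equiv> {r. r < m \<and> \<bar>dotp d (u0 r) (x i)\<bar> \<le> R}"
abbreviation "near w \<equiv> (\<forall>r<m. nm (\<lambda>k. w r k - u0 r k) \<le> R)"

definition Gram where
  "Gram i j = (1 / real m) * (\<Sum>r<m. dotp d (x i) (x j) *
         (if dotp d (u0 r) (x i) \<ge> 0 \<and> dotp d (u0 r) (x j) \<ge> 0 then 1 else 0))"

lemma q_nonneg: "q \<ge> 0"
  using few_unstable[of 0] n by simp

text \<open>Both sources of error, changed activations in the gradient and the kink of ReLU, vanish
  on stable neurons; this turns each into a count of at most \<open>q\<close> terms.\<close>

lemma sum_unstable_le:
  assumes i: "i < n" and b: "b \<ge> 0"
    and f: "\<And>r. r < m \<Longrightarrow> r \<in> unstable i \<Longrightarrow> \<bar>f r\<bar> \<le> b"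
           "\<And>r. r < m \<Longrightarrow> r \<notin> unstable i \<Longrightarrow> f r = 0"
  shows "\<bar>\<Sum>r<m. f r\<bar> \<le> q * b"
proof -
  have "(\<Sum>r<m. f r) = (\<Sum>r\<in>unstable i. f r)"
    by (rule sum.mono_neutral_right) (use f(2) in auto)
  then have "\<bar>\<Sum>r<m. f r\<bar> \<le> (\<Sum>r\<in>unstable i. b)"
    using f(1) by (simp only:) (intro order_trans[OF sum_abs] sum_mono, auto)
  also have "\<dots> = real (card (unstable i)) * b" by simp
  also have "\<dots> \<le> q * b"
    by (intro mult_right_mono few_unstable i b)
  finally show ?thesis .
qed

lemma dotp_near:
  assumes "near w" "r < m" "i < n"
  shows "\<bar>dotp d (w r) (x i) - dotp d (u0 r) (x i)\<bar> \<le> R"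
  using assms abs_dotp_le[of d "\<lambda>k. w r k - u0 r k" "x i"] x_norm[of i]
  by (fastforce simp: dotp_diff_left)

text \<open>A preactivation that starts farther than \<open>R\<close> from 0 cannot cross 0 when it
  moves by at most \<open>R\<close>.\<close>

lemma act_stable:
  assumes "near w" "r < m" "i < n" "r \<notin> unstable i"
  shows "act w r i = act u0 r i"
  using dotp_near[OF assms(1-3)] assms by (auto simp: abs_if split: if_splits)

text \<open>Both end points have the initial activation, so ReLU acts on them as the same linear
  map.\<close>

lemma relu_stable:
  assumes "near w" "near w'" "r < m" "i < n" "r \<notin> unstable i"
  shows "relu (dotp d (w' r) (x i)) - relu (dotp d (w r) (x i))
    = act u0 r i * dotp d (\<lambda>k. w' r k - w r k) (x i)"
  using act_stable[OF assms(1,3-5)] act_stable[OF assms(2,3-5)]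
  by (auto simp: relu_def dotp_diff_left split: if_splits)

context
  fixes u :: "nat \<Rightarrow> nat \<Rightarrow> real"
  assumes u: "\<And>r. r < m \<Longrightarrow>
    nm (\<lambda>k. u r k - u0 r k) + 2 * \<eta>l * real K * E u / sqrt (real m) \<le> R"
begin

lemma E_nonneg: "E u \<ge> 0"
  by (intro sum_nonneg) auto

text \<open>The assumption on \<open>u\<close> reserves room for this displacement, which bounds the
  drift of every local iterate and, since \<open>\<alpha> \<le> \<eta>l * K\<close>, also the
  averaged round.\<close>

lemma near_of_move:
  assumes "\<And>r. r < m \<Longrightarrow> nm (\<lambda>k. w r k - u r k) \<le> 2 * \<eta>l * real K * E u / sqrt (real m)"
  shows "near w"
proof (intro allI impI)
  fix r assume r: "r < m"
  have "nm (\<lambda>k. w r k - u0 r k) = nm (\<lambda>k. (w r k - u r k) + (u r k - u0 r k))" by simp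
  also have "\<dots> \<le> nm (\<lambda>k. w r k - u r k) + nm (\<lambda>k. u r k - u0 r k)"
    by (rule L2_set_triangle_ineq)
  also have "\<dots> \<le> R" using assms[OF r] u[OF r] by linarith
  finally show "nm (\<lambda>k. w r k - u0 r k) \<le> R" .
qed

lemma near_u: "near u"
  by (rule near_of_move) (use \<eta>l E_nonneg in \<open>simp add: L2_set_def\<close>)

lemma near_W:
  assumes "c < N" "k \<le> K"
  shows "near (W c k u)"
proof (rule near_of_move)
  fix r assume "r < m"
  show "nm (\<lambda>j. W c k u r j - u r j) \<le> 2 * \<eta>l * real K * E u / sqrt (real m)"
    using assms \<open>r < m\<close> \<eta>l
    by (intro order_trans[OF norm_iterate] divide_right_mono mult_left_mono E1_le) auto
qed

lemma near_upd: "near (upd u)"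
proof (rule near_of_move)
  fix r assume "r < m"
  have "2 * \<alpha> * E u / sqrt (real m) \<le> 2 * (\<eta>l * real K) * E u / sqrt (real m)"
    using \<alpha>_le E_nonneg by (intro divide_right_mono mult_right_mono) auto
  then show "nm (\<lambda>j. upd u r j - u r j) \<le> 2 * \<eta>l * real K * E u / sqrt (real m)"
    using norm_upd[OF \<open>r < m\<close>, of u] by (simp add: mult.assoc)
qed

text \<open>The kernel through which local step k of client c acts on the output at point i: the
  initial activation at i, where the output is linearised, and the current activation at j, where
  the gradient is taken.\<close>

definition Gram_local where
  "Gram_local c k i j = (1 / real m) * (\<Sum>r<m. act u0 r i * dotp d (x j) (x i) * act (W c k u) r j)"

lemma abs_dotp_x: "i < n \<Longrightarrow> j < n \<Longrightarrow> \<bar>dotp d (x i) (x j)\<bar> \<le> 1"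
  using abs_dotp_le[of d "x i" "x j"] by (simp add: x_norm)

text \<open>Only the activations at j differ, on at most \<open>q\<close> of the m neurons, and each
  summand is at most 1 for unit data.\<close>

lemma Gram_local_diff:
  assumes "c < N" "k \<le> K" "i < n" "j < n"
  shows "\<bar>Gram_local c k i j - Gram i j\<bar> \<le> q / real m"
proof -
  have "Gram_local c k i j - Gram i j = (1 / real m) *
     (\<Sum>r<m. act u0 r i * dotp d (x j) (x i) * (act (W c k u) r j - act u0 r j))"
    unfolding Gram_local_def Gram_def right_diff_distrib[symmetric] sum_subtractf[symmetric]
    by (intro arg_cong2[where f = "(*)"] sum.cong refl) (auto simp: dotp_commute)
  moreover have "\<bar>\<Sum>r<m. act u0 r i * dotp d (x j) (x i) * (act (W c k u) r j - act u0 r j)\<bar> \<le> q * 1"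
  proof (rule sum_unstable_le[OF assms(4)])
    fix r assume "r < m" "r \<notin> unstable j"
    with act_stable[OF near_W[OF assms(1,2)], of r j] assms
    show "act u0 r i * dotp d (x j) (x i) * (act (W c k u) r j - act u0 r j) = 0" by simp
  next
    fix r
    show "\<bar>act u0 r i * dotp d (x j) (x i) * (act (W c k u) r j - act u0 r j)\<bar> \<le> 1"
      using abs_dotp_x[of j i] assms by (auto simp: abs_mult)
  qed simp
  ultimately show ?thesis by (simp add: abs_mult divide_right_mono)
qed

lemma abs_Gram:
  assumes "i < n" "j < n"
  shows "\<bar>Gram i j\<bar> \<le> 1"
proof -
  have "\<bar>\<Sum>r<m. dotp d (x i) (x j) *
         (if dotp d (u0 r) (x i) \<ge> 0 \<and> dotp d (u0 r) (x j) \<ge> 0 then 1 else 0)\<bar> \<le> (\<Sum>r<m. 1)"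
    by (intro order_trans[OF sum_abs] sum_mono) (use abs_dotp_x[OF assms] in \<open>auto simp: abs_mult\<close>)
  then show ?thesis using m by (simp add: Gram_def abs_mult divide_le_eq)
qed

text \<open>The change of the output at i if every neuron kept its initial activation on
  \<open>x i\<close>.\<close>

definition "lin i = (1 / sqrt (real m)) * (\<Sum>r<m. a r * act u0 r i * dotp d (\<lambda>k. upd u r k - u r k) (x i))"

text \<open>The sign \<open>a r\<close> occurs once in the output and once in the gradient, and its
  square is 1. The two factors 1 / sqrt m combine to the 1 / m of \<open>Gram_local\<close>.\<close>

lemma lin_eq:
  "lin i = - (\<eta>g * \<eta>l / real N) *
    (\<Sum>c<N. \<Sum>k<K. \<Sum>j\<in>S c. res (W c k u) j * Gram_local c k i j)"
proof -
  define F where "F r c k j = a r * act u0 r i * (res (W c k u) j * a r * act (W c k u) r j * dotp d (x j) (x i))"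
    for r c k j
  define p where "p = \<eta>g * \<eta>l / (real N * sqrt (real m))"
  have swap: "(\<Sum>r<m. \<Sum>c<N. \<Sum>k<K. \<Sum>j\<in>S c. F r c k j) = (\<Sum>c<N. \<Sum>k<K. \<Sum>j\<in>S c. \<Sum>r<m. F r c k j)"
    apply (subst sum.swap, rule sum.cong[OF refl])
    apply (subst sum.swap, rule sum.cong[OF refl])
    apply (rule sum.swap)
    done
  have F: "(\<Sum>r<m. F r c k j) = real m * (res (W c k u) j * Gram_local c k i j)" for c k j
  proof -
    have "F r c k j = res (W c k u) j * (act u0 r i * dotp d (x j) (x i) * act (W c k u) r j)" if "r < m" for r
      using a[OF that] by (auto simp: F_def)
    then have "(\<Sum>r<m. F r c k j) = (\<Sum>r<m. res (W c k u) j * (act u0 r i * dotp d (x j) (x i) * act (W c k u) r j))"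
      by (intro sum.cong) auto
    also have "\<dots> = res (W c k u) j * (\<Sum>r<m. act u0 r i * dotp d (x j) (x i) * act (W c k u) r j)"
      by (rule sum_distrib_left[symmetric])
    finally show ?thesis using m by (simp add: Gram_local_def)
  qed
  have "(\<Sum>r<m. a r * act u0 r i * dotp d (\<lambda>k. upd u r k - u r k) (x i))
      = (\<Sum>r<m. (- p) * (\<Sum>c<N. \<Sum>k<K. \<Sum>j\<in>S c. F r c k j))"
    by (rule sum.cong[OF refl], unfold dotp_upd F_def p_def sum_distrib_left[symmetric])
      (simp add: mult.commute mult.left_commute)
  also have "\<dots> = (- p) * (\<Sum>r<m. \<Sum>c<N. \<Sum>k<K. \<Sum>j\<in>S c. F r c k j)"
    by (rule sum_distrib_left[symmetric])
  also have "\<dots> = (- p) * (real m * (\<Sum>c<N. \<Sum>k<K. \<Sum>j\<in>S c. res (W c k u) j * Gram_local c k i j))"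
    unfolding swap F by (simp only: sum_distrib_left)
  finally show ?thesis using m by (simp add: lin_def p_def field_simps)
qed

text \<open>Two replacements are made. Passing from \<open>Gram_local\<close> to \<open>Gram\<close>
  costs q / m per entry, weighted by local residuals whose l1 norm has at most doubled. Passing from
  local residuals to those at \<open>u\<close> costs 2 \<open>\<eta>l * K * E1 c u\<close> for each
  of at most n points.\<close>

lemma lin_approx:
  assumes i: "i < n"
  shows "\<bar>lin i + \<alpha> * (\<Sum>j<n. Gram i j * res u j)\<bar>
    \<le> \<alpha> * E u * (2 * q / real m + 2 * real n * \<eta>l * real K)"
proof -
  \<comment> \<open>Written as a triple sum whose summand is constant in k, the exact gradient step
    can be compared with the local steps term by term.\<close>
  have HS: "real K * (\<Sum>j<n. Gram i j * res u j) = (\<Sum>c<N. \<Sum>k<K. \<Sum>j\<in>S c. Gram i j * res u j)"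
    by (simp add: sum_S flip: sum_distrib_left)
  have "lin i + \<alpha> * (\<Sum>j<n. Gram i j * res u j) = - (\<eta>g * \<eta>l / real N) *
     ((\<Sum>c<N. \<Sum>k<K. \<Sum>j\<in>S c. res (W c k u) j * Gram_local c k i j)
      - real K * (\<Sum>j<n. Gram i j * res u j))"
    unfolding lin_eq by (simp add: algebra_simps \<alpha>_def)
  also have "\<dots> = - (\<eta>g * \<eta>l / real N) *
     (\<Sum>c<N. \<Sum>k<K. \<Sum>j\<in>S c. res (W c k u) j * Gram_local c k i j - Gram i j * res u j)"
    unfolding HS by (simp add: sum_subtractf)
  finally have "\<bar>lin i + \<alpha> * (\<Sum>j<n. Gram i j * res u j)\<bar> = \<eta>g * \<eta>l / real N *
     \<bar>\<Sum>c<N. \<Sum>k<K. \<Sum>j\<in>S c. res (W c k u) j * Gram_local c k i j - Gram i j * res u j\<bar>"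
    using \<eta>l \<eta>g by (simp add: abs_mult)
  also have "\<dots> \<le> \<eta>g * \<eta>l / real N * (\<Sum>c<N. real K * (E1 c u * (2 * q / real m + 2 * real n * \<eta>l * real K)))"
  proof (rule mult_left_mono, rule order_trans[OF sum_abs sum_mono])
    fix c assume "c \<in> {..<N}"
    then have c: "c < N" by simp
    have "\<bar>\<Sum>j\<in>S c. res (W c k u) j * Gram_local c k i j - Gram i j * res u j\<bar>
        \<le> E1 c u * (2 * q / real m + 2 * real n * \<eta>l * real K)" if k: "k < K" for k
    proof -
      have "\<bar>res (W c k u) j * Gram_local c k i j - Gram i j * res u j\<bar>
          \<le> \<bar>res (W c k u) j\<bar> * (q / real m) + 2 * \<eta>l * real K * E1 c u" if "j \<in> S c" for j
      proof -
        have j: "j < n" using S_sub[OF c] that by auto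
        have eq: "res (W c k u) j * Gram_local c k i j - Gram i j * res u j
          = res (W c k u) j * (Gram_local c k i j - Gram i j) + (res (W c k u) j - res u j) * Gram i j"
          by (simp add: algebra_simps)
        have "\<bar>res (W c k u) j * Gram_local c k i j - Gram i j * res u j\<bar>
          \<le> \<bar>res (W c k u) j\<bar> * \<bar>Gram_local c k i j - Gram i j\<bar>
            + \<bar>res (W c k u) j - res u j\<bar> * \<bar>Gram i j\<bar>"
          unfolding eq abs_mult[symmetric] by (rule abs_triangle_ineq)
        also have "\<dots> \<le> \<bar>res (W c k u) j\<bar> * (q / real m) + (2 * \<eta>l * real K * E1 c u) * 1"
          using Gram_local_diff[OF c _ i j, of k] res_iterate[OF c j, of k u] abs_Gram[OF i j] k \<eta>l
          by (intro add_mono mult_mono) (auto intro!: mult_nonneg_nonneg sum_nonneg)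
        finally show ?thesis by simp
      qed
      then have "\<bar>\<Sum>j\<in>S c. res (W c k u) j * Gram_local c k i j - Gram i j * res u j\<bar>
          \<le> (\<Sum>j\<in>S c. \<bar>res (W c k u) j\<bar> * (q / real m) + 2 * \<eta>l * real K * E1 c u)"
        by (intro order_trans[OF sum_abs] sum_mono)
      also have "\<dots> = E1 c (W c k u) * (q / real m) + real (card (S c)) * (2 * \<eta>l * real K * E1 c u)"
        by (simp add: sum.distrib sum_distrib_right sum_divide_distrib)
      also have "\<dots> \<le> (2 * E1 c u) * (q / real m) + real n * (2 * \<eta>l * real K * E1 c u)"
        using E1_iterate[OF c, of k u] card_S[OF c] k q_nonneg \<eta>l
        by (intro add_mono mult_right_mono) (auto intro!: mult_nonneg_nonneg sum_nonneg)
      finally show ?thesis by (simp add: algebra_simps)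
    qed
    then have "\<bar>\<Sum>k<K. \<Sum>j\<in>S c. res (W c k u) j * Gram_local c k i j - Gram i j * res u j\<bar>
        \<le> (\<Sum>k<K. E1 c u * (2 * q / real m + 2 * real n * \<eta>l * real K))"
      by (rule order_trans[OF sum_abs sum_mono]) auto
    then show "\<bar>\<Sum>k<K. \<Sum>j\<in>S c. res (W c k u) j * Gram_local c k i j - Gram i j * res u j\<bar>
        \<le> real K * (E1 c u * (2 * q / real m + 2 * real n * \<eta>l * real K))" by simp
  qed (use \<eta>l \<eta>g in auto)
  also have "\<dots> = \<eta>g * \<eta>l / real N * (real K * ((\<Sum>c<N. E1 c u) * (2 * q / real m + 2 * real n * \<eta>l * real K)))"
    by (simp only: sum_distrib_left sum_distrib_right)
  also have "\<dots> = \<alpha> * E u * (2 * q / real m + 2 * real n * \<eta>l * real K)"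
    unfolding sum_S by (simp add: \<alpha>_def)
  finally show ?thesis .
qed

text \<open>Only unstable neurons contribute. For each of them the increment of ReLU and its linear
  model are both bounded by the displacement 2 \<open>\<alpha> * E u / sqrt m\<close>, which gives 4
  q / m.\<close>

lemma net_upd_lin:
  assumes i: "i < n"
  shows "\<bar>res (upd u) i - res u i - lin i\<bar> \<le> \<alpha> * E u * (4 * q / real m)"
proof -
  define f where "f r = a r * (relu (dotp d (upd u r) (x i)) - relu (dotp d (u r) (x i))
      - act u0 r i * dotp d (\<lambda>k. upd u r k - u r k) (x i))" for r
  have "res (upd u) i - res u i - lin i = (1 / sqrt (real m)) * (\<Sum>r<m. f r)"
    unfolding lin_def f_def diff_diff_eq2 using net_diff[of d m a "upd u" "x i" u]
    by (simp add: right_diff_distrib sum_subtractf mult.assoc)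
  moreover have "\<bar>\<Sum>r<m. f r\<bar> \<le> q * (2 * (2 * \<alpha> * E u / sqrt (real m)))"
  proof (rule sum_unstable_le[OF i])
    fix r assume r: "r < m"
    have *: "\<bar>dotp d (\<lambda>k. upd u r k - u r k) (x i)\<bar> \<le> 2 * \<alpha> * E u / sqrt (real m)"
      using abs_dotp_le[of d "\<lambda>k. upd u r k - u r k" "x i"] x_norm[OF i] norm_upd[OF r, of u] by simp
    have "\<bar>f r\<bar> \<le> \<bar>relu (dotp d (upd u r) (x i)) - relu (dotp d (u r) (x i))\<bar>
        + \<bar>dotp d (\<lambda>k. upd u r k - u r k) (x i)\<bar>"
      unfolding f_def abs_mult a_abs[OF r] by auto
    also have "\<dots> \<le> \<bar>dotp d (\<lambda>k. upd u r k - u r k) (x i)\<bar> + \<bar>dotp d (\<lambda>k. upd u r k - u r k) (x i)\<bar>"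
      using relu_lipschitz[of "dotp d (upd u r) (x i)" "dotp d (u r) (x i)"] by (simp add: dotp_diff_left)
    finally show "\<bar>f r\<bar> \<le> 2 * (2 * \<alpha> * E u / sqrt (real m))" using * by linarith
  next
    fix r assume "r < m" "r \<notin> unstable i"
    then show "f r = 0"
      using relu_stable[OF near_u near_upd, of r i] i by (simp add: f_def)
  qed (use \<alpha>_pos E_nonneg in auto)
  ultimately have "\<bar>res (upd u) i - res u i - lin i\<bar> \<le> (1 / sqrt (real m)) * (q * (2 * (2 * \<alpha> * E u / sqrt (real m))))"
    by (simp only: abs_mult) (intro mult_mono, auto)
  also have "\<dots> = \<alpha> * E u * (4 * q / (sqrt (real m) * sqrt (real m)))"
    by simp
  finally show ?thesis by simp
qed

lemma upd_approx:
  assumes i: "i < n"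
  shows "\<bar>res (upd u) i - res u i + \<alpha> * (\<Sum>j<n. Gram i j * res u j)\<bar>
    \<le> \<alpha> * E u * (6 * q / real m + 2 * real n * \<eta>l * real K)"
proof -
  have "\<alpha> * E u * (6 * q / real m + 2 * real n * \<eta>l * real K)
      = \<alpha> * E u * (2 * q / real m + 2 * real n * \<eta>l * real K) + \<alpha> * E u * (4 * q / real m)"
    by (simp add: algebra_simps)
  then show ?thesis
    using net_upd_lin[OF i] lin_approx[OF i] by linarith
qed

lemma upd_move:
  assumes i: "i < n"
  shows "\<bar>res (upd u) i - res u i\<bar> \<le> 2 * \<alpha> * E u"
  using norm_upd by (intro res_diff_le[OF i]) auto

text \<open>In the expansion of the squared norm of e + D, coercivity makes the cross term
  contribute -2 \<open>\<alpha> * lam\<close>. The approximation error and the quadratic term give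
  back at most 3/2 \<open>\<alpha> * lam\<close>, which leaves the rate
  \<open>\<alpha> * lam / 2\<close>.\<close>

lemma pred_err_upd:
  "pred_err n d m a x y (upd u) \<le> (1 - \<alpha> * lam / 2) * pred_err n d m a x y u"
proof -
  define P where "P = pred_err n d m a x y u"
  define D where "D i = res (upd u) i - res u i" for i
  define \<beta> where "\<beta> = 6 * q / real m + 2 * real n * \<eta>l * real K"
  have P: "P = (\<Sum>i<n. (res u i)\<^sup>2)" by (simp add: P_def pred_err_def)
  have P0: "P \<ge> 0" unfolding P by (intro sum_nonneg) auto
  have \<beta>0: "\<beta> \<ge> 0" using q_nonneg \<eta>l by (simp add: \<beta>_def)
  have EP: "(E u)\<^sup>2 \<le> real n * P"
  proof -
    have "(E u)\<^sup>2 \<le> (sqrt (real n) * sqrt P)\<^sup>2"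
      using sum_abs_le_sqrt[of "res u" n] E_nonneg P by (intro power_mono) auto
    then show ?thesis using P0 by (simp add: power_mult_distrib)
  qed
  have cross: "(\<Sum>i<n. res u i * D i) \<le> - \<alpha> * lam * P + \<alpha> * \<beta> * (E u)\<^sup>2"
  proof -
    have "res u i * D i \<le> - \<alpha> * (res u i * (\<Sum>j<n. Gram i j * res u j)) + \<bar>res u i\<bar> * (\<alpha> * E u * \<beta>)"
      if "i < n" for i
    proof -
      let ?h = "\<alpha> * (\<Sum>j<n. Gram i j * res u j)"
      have "res u i * (D i + ?h) \<le> \<bar>res u i\<bar> * \<bar>D i + ?h\<bar>"
        by (rule order_trans[OF abs_ge_self]) (simp only: abs_mult order_refl)
      also have "\<dots> \<le> \<bar>res u i\<bar> * (\<alpha> * E u * \<beta>)"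
        using upd_approx[OF that] by (intro mult_left_mono) (auto simp: D_def \<beta>_def)
      finally show ?thesis by (simp add: algebra_simps)
    qed
    then have "(\<Sum>i<n. res u i * D i) \<le> (\<Sum>i<n. - \<alpha> * (res u i * (\<Sum>j<n. Gram i j * res u j)) + \<bar>res u i\<bar> * (\<alpha> * E u * \<beta>))"
      by (intro sum_mono) auto
    also have "\<dots> = - \<alpha> * (\<Sum>i<n. res u i * (\<Sum>j<n. Gram i j * res u j)) + E u * (\<alpha> * E u * \<beta>)"
      by (simp only: sum.distrib sum_distrib_left[symmetric] sum_distrib_right[symmetric])
    also have "\<dots> \<le> - \<alpha> * (lam * P) + E u * (\<alpha> * E u * \<beta>)"
      using coercive[of "res u"] \<alpha>_pos by (intro add_right_mono mult_left_mono_neg) (auto simp: P Gram_def)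
    finally show ?thesis by (simp add: power2_eq_square algebra_simps)
  qed
  have sq: "(\<Sum>i<n. (D i)\<^sup>2) \<le> real n * (4 * \<alpha>\<^sup>2 * (E u)\<^sup>2)"
  proof -
    have "(D i)\<^sup>2 \<le> 4 * \<alpha>\<^sup>2 * (E u)\<^sup>2" if "i < n" for i
    proof -
      have "\<bar>D i\<bar>\<^sup>2 \<le> (2 * \<alpha> * E u)\<^sup>2"
        using upd_move[OF that] by (intro power_mono) (auto simp: D_def)
      then show ?thesis by (simp add: power_mult_distrib)
    qed
    then have "(\<Sum>i<n. (D i)\<^sup>2) \<le> (\<Sum>i<n. 4 * \<alpha>\<^sup>2 * (E u)\<^sup>2)" by (intro sum_mono) auto
    then show ?thesis by simp
  qed
  have "pred_err n d m a x y (upd u) = (\<Sum>i<n. (res u i)\<^sup>2 + 2 * (res u i * D i) + (D i)\<^sup>2)"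
    unfolding pred_err_def D_def by (intro sum.cong) (auto simp: power2_eq_square algebra_simps)
  also have "\<dots> = P + 2 * (\<Sum>i<n. res u i * D i) + (\<Sum>i<n. (D i)\<^sup>2)"
    by (simp add: sum.distrib P sum_distrib_left)
  also have "\<dots> \<le> P + 2 * (- \<alpha> * lam * P + \<alpha> * \<beta> * (E u)\<^sup>2) + real n * (4 * \<alpha>\<^sup>2 * (E u)\<^sup>2)"
    by (intro add_mono mult_left_mono order_refl cross sq) simp
  also have "\<dots> = P - 2 * \<alpha> * lam * P + (2 * \<alpha> * \<beta> + 4 * real n * \<alpha>\<^sup>2) * (E u)\<^sup>2"
    by (simp add: algebra_simps)
  also have "\<dots> \<le> P - 2 * \<alpha> * lam * P + (2 * \<alpha> * \<beta> + 4 * real n * \<alpha>\<^sup>2) * (real n * P)"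
    using EP \<alpha>_pos \<beta>0 by (intro add_left_mono mult_left_mono) auto
  also have "\<dots> = P - 2 * \<alpha> * lam * P + \<alpha> * P * (2 * \<beta> * real n + 4 * (real n)\<^sup>2 * \<alpha>)"
    by (simp add: power2_eq_square algebra_simps)
  also have "\<dots> \<le> P - 2 * \<alpha> * lam * P + \<alpha> * P * (3 / 2 * lam)"
  proof (intro add_left_mono mult_left_mono)
    \<comment> \<open>Flipped activations use up one \<open>lam\<close>; the local drift and the
      quadratic term use \<open>lam / 25\<close> each.\<close>
    have "12 * real n * q / real m \<le> lam"
      using q_small m by (simp add: divide_le_eq)
    moreover have "(real n)\<^sup>2 * \<alpha> \<le> (real n)\<^sup>2 * (\<eta>l * real K)"
      using \<alpha>_le by (intro mult_left_mono) auto
    moreover have "(real n)\<^sup>2 * (\<eta>l * real K) \<le> lam / 100"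
      using \<eta>l_lam by (simp add: mult.commute)
    moreover have "2 * \<beta> * real n = 12 * real n * q / real m + 4 * ((real n)\<^sup>2 * (\<eta>l * real K))"
      by (simp add: \<beta>_def algebra_simps power2_eq_square)
    moreover have "4 * (real n)\<^sup>2 * \<alpha> = 4 * ((real n)\<^sup>2 * \<alpha>)" by simp
    ultimately show "2 * \<beta> * real n + 4 * (real n)\<^sup>2 * \<alpha> \<le> 3 / 2 * lam"
      using lam by linarith
  qed (use \<alpha>_pos P0 in auto)
  also have "\<dots> = (1 - \<alpha> * lam / 2) * P" by (simp add: algebra_simps)
  finally show ?thesis by (simp add: P_def)
qed

end

section \<open>Convergence along the trajectory\<close>

abbreviation "traj t \<equiv> fedavg d m N K a x y S \<eta>l \<eta>g u0 t"
abbreviation "err t \<equiv> pred_err n d m a x y (traj t)"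

text \<open>The two claims are proved by a joint induction: contraction needs the neurons to be near
  their start, and nearness follows from the geometric decay of earlier residuals. The geometric
  series bounds the past displacement by 8 Q / (lam sqrt m), and one more Q / (lam sqrt m) is
  reserved for the local steps of the current round; hence the 9.\<close>

lemma convergence:
  assumes R: "9 * sqrt (real n) * sqrt (pred_err n d m a x y u0) \<le> R * lam * sqrt (real m)"
  shows "err t \<le> (1 - \<alpha> * lam / 2) ^ t * pred_err n d m a x y u0"
proof -
  \<comment> \<open>Decay rate of the norm, as opposed to the squared norm: an upper bound for sqrt
    (1 - \<open>\<alpha> * lam / 2\<close>) that avoids the root.\<close>
  define b where "b = 1 - \<alpha> * lam / 4"
  define Q where "Q = sqrt (real n) * sqrt (pred_err n d m a x y u0)"
  have \<alpha>1: "\<alpha> * lam \<le> 1 / 100"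
  proof -
    have "\<alpha> * lam \<le> \<alpha>" using \<alpha>_pos lam by (simp add: mult_left_le)
    also have "\<dots> \<le> \<eta>l * real K * real n"
      using mult_left_mono[of 1 "real n" "\<eta>l * real K"] n \<eta>l by (intro order_trans[OF \<alpha>_le]) simp
    finally show ?thesis using \<eta>l_small by linarith
  qed
  have b: "0 < b" "b < 1" using \<alpha>1 \<alpha>_pos lam by (auto simp: b_def)
  have err0: "err 0 \<ge> 0" "pred_err n d m a x y u0 \<ge> 0"
    by (auto simp: pred_err_def intro: sum_nonneg)
  have bb: "1 - \<alpha> * lam / 2 \<le> b\<^sup>2"
    using \<alpha>_pos lam by (simp add: b_def power2_eq_square algebra_simps zero_le_mult_iff)
  have E_le: "E (traj t) \<le> b ^ t * Q" if "err t \<le> (1 - \<alpha> * lam / 2) ^ t * pred_err n d m a x y u0" for t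
  proof -
    have "(1 - \<alpha> * lam / 2) ^ t \<le> (b\<^sup>2) ^ t"
      using bb \<alpha>1 by (intro power_mono) auto
    then have "err t \<le> (b ^ t)\<^sup>2 * pred_err n d m a x y u0"
      using that mult_right_mono[OF _ err0(2)] by (fastforce simp: power_mult[symmetric] mult.commute)
    then have "sqrt (err t) \<le> b ^ t * sqrt (pred_err n d m a x y u0)"
      using b real_sqrt_le_mono by (fastforce simp: real_sqrt_mult)
    then have "sqrt (real n) * sqrt (err t) \<le> sqrt (real n) * (b ^ t * sqrt (pred_err n d m a x y u0))"
      by (intro mult_left_mono) auto
    then show ?thesis
      using sum_abs_le_sqrt[of "res (traj t)" n]
      by (simp add: pred_err_def Q_def mult.commute mult.left_commute)
  qed
  have Q0: "Q \<ge> 0" using err0 by (simp add: Q_def)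
  have "err t \<le> (1 - \<alpha> * lam / 2) ^ t * pred_err n d m a x y u0
     \<and> (\<forall>r<m. nm (\<lambda>k. traj t r k - u0 r k) \<le> 2 * \<alpha> / sqrt (real m) * Q * ((1 - b ^ t) / (1 - b)))"
  proof (induction t)
    case 0
    then show ?case by (simp add: L2_set_def)
  next
    case (Suc t)
    have upd: "traj (Suc t) = upd (traj t)" by (rule fedavg_Suc)
    have Et: "E (traj t) \<le> b ^ t * Q" using E_le Suc by blast
    have Q': "9 * Q / (lam * sqrt (real m)) \<le> R"
      using R lam m by (simp add: Q_def divide_le_eq mult.assoc)
    have close: "nm (\<lambda>k. traj t r k - u0 r k) + 2 * \<eta>l * real K * E (traj t) / sqrt (real m) \<le> R"
      if r: "r < m" for r
    proof -
      have "nm (\<lambda>k. traj t r k - u0 r k) \<le> 2 * \<alpha> / sqrt (real m) * Q * ((1 - b ^ t) / (1 - b))"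
        using Suc r by blast
      also have "\<dots> \<le> 2 * \<alpha> / sqrt (real m) * Q * (1 / (1 - b))"
        using b Q0 \<alpha>_pos by (intro mult_left_mono divide_right_mono) auto
      also have "\<dots> = 8 * Q / (lam * sqrt (real m))"
        using \<alpha>_pos lam by (simp add: b_def field_simps)
      finally have 1: "nm (\<lambda>k. traj t r k - u0 r k) \<le> 8 * Q / (lam * sqrt (real m))" .
      have "E (traj t) \<le> Q"
        using Et b mult_left_le_one_le[OF Q0, of "b ^ t"] by (simp add: power_le_one)
      moreover have "2 * \<eta>l * real K \<le> 1"
      proof -
        have "\<eta>l * real K \<le> \<eta>l * real K * real n"
          using mult_left_mono[of 1 "real n" "\<eta>l * real K"] n \<eta>l by simp
        then show ?thesis using \<eta>l_small by linarith
      qed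
      ultimately have "(2 * \<eta>l * real K) * E (traj t) \<le> 1 * Q"
        using \<eta>l Q0 by (intro mult_mono) (auto intro: sum_nonneg)
      then have "2 * \<eta>l * real K * E (traj t) / sqrt (real m) \<le> Q / sqrt (real m)"
        by (intro divide_right_mono) auto
      also have "\<dots> \<le> Q / (lam * sqrt (real m))"
        using lam Q0 m by (intro divide_left_mono) (auto simp: mult_left_le_one_le)
      finally have 2: "2 * \<eta>l * real K * E (traj t) / sqrt (real m) \<le> Q / (lam * sqrt (real m))" .
      have "8 * Q / (lam * sqrt (real m)) + Q / (lam * sqrt (real m)) = 9 * Q / (lam * sqrt (real m))"
        by (simp add: add_divide_distrib[symmetric])
      with Q' have "8 * Q / (lam * sqrt (real m)) + Q / (lam * sqrt (real m)) \<le> R" by (simp only:)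
      with add_mono[OF 1 2] show ?thesis by (rule order_trans)
    qed
    have "err (Suc t) \<le> (1 - \<alpha> * lam / 2) * err t"
      unfolding upd by (rule pred_err_upd) (rule close)
    also have "\<dots> \<le> (1 - \<alpha> * lam / 2) * ((1 - \<alpha> * lam / 2) ^ t * pred_err n d m a x y u0)"
      using Suc \<alpha>1 by (intro mult_left_mono) auto
    finally have 1: "err (Suc t) \<le> (1 - \<alpha> * lam / 2) ^ Suc t * pred_err n d m a x y u0"
      by (simp add: mult.assoc)
    have 2: "nm (\<lambda>k. traj (Suc t) r k - u0 r k) \<le> 2 * \<alpha> / sqrt (real m) * Q * ((1 - b ^ Suc t) / (1 - b))"
      if r: "r < m" for r
    proof -
      have "nm (\<lambda>k. traj (Suc t) r k - u0 r k)
          = nm (\<lambda>k. (upd (traj t) r k - traj t r k) + (traj t r k - u0 r k))"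
        unfolding upd by simp
      also have "\<dots> \<le> nm (\<lambda>k. upd (traj t) r k - traj t r k) + nm (\<lambda>k. traj t r k - u0 r k)"
        by (rule L2_set_triangle_ineq)
      also have "\<dots> \<le> 2 * \<alpha> / sqrt (real m) * Q * b ^ t
          + 2 * \<alpha> / sqrt (real m) * Q * ((1 - b ^ t) / (1 - b))"
      proof (rule add_mono)
        have "nm (\<lambda>k. upd (traj t) r k - traj t r k) \<le> 2 * \<alpha> * E (traj t) / sqrt (real m)"
          by (rule norm_upd[OF r])
        also have "\<dots> \<le> 2 * \<alpha> * (b ^ t * Q) / sqrt (real m)"
          using Et \<alpha>_pos by (intro divide_right_mono mult_left_mono) auto
        also have "\<dots> = 2 * \<alpha> / sqrt (real m) * Q * b ^ t" by simp
        finally show "nm (\<lambda>k. upd (traj t) r k - traj t r k) \<le> 2 * \<alpha> / sqrt (real m) * Q * b ^ t" .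
      qed (use Suc r in blast)
      also have "\<dots> = 2 * \<alpha> / sqrt (real m) * Q * (b ^ t + (1 - b ^ t) / (1 - b))"
        by (simp only: distrib_left)
      also have "b ^ t + (1 - b ^ t) / (1 - b) = (1 - b ^ Suc t) / (1 - b)"
        using b by (simp add: field_simps)
      finally show ?thesis .
    qed
    show ?case using 1 2 by blast
  qed
  then show ?thesis by blast
qed

end

section \<open>Smallest eigenvalue of a symmetric matrix\<close>

text \<open>Stated for index functions rather than vectors, to agree with the sums in the hypothesis
  \<open>coercive\<close>.\<close>

definition bilin :: "nat \<Rightarrow> (nat \<Rightarrow> nat \<Rightarrow> real) \<Rightarrow> (nat \<Rightarrow> real) \<Rightarrow> (nat \<Rightarrow> real) \<Rightarrow> real" where
  "bilin n B f g = (\<Sum>i<n. f i * (\<Sum>j<n. B i j * g j))"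

lemma bilin_commute:
  assumes "\<And>i j. i < n \<Longrightarrow> j < n \<Longrightarrow> B i j = B j i"
  shows "bilin n B f g = bilin n B g f"
proof -
  have "bilin n B f g = (\<Sum>i<n. \<Sum>j<n. f i * (B i j * g j))"
    by (simp add: bilin_def sum_distrib_left)
  also have "\<dots> = (\<Sum>j<n. \<Sum>i<n. f i * (B i j * g j))"
    by (rule sum.swap)
  also have "\<dots> = (\<Sum>j<n. \<Sum>i<n. g j * (B j i * f i))"
    using assms by (intro sum.cong) auto
  finally show ?thesis by (simp add: bilin_def sum_distrib_left)
qed

lemma bilin_diff_scale_left:
  "bilin n B (\<lambda>i. f i - c * g i) h = bilin n B f h - c * bilin n B g h"
  by (simp add: bilin_def algebra_simps sum_subtractf sum_distrib_left)

lemma bilin_diff_scale_right: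
  "bilin n B h (\<lambda>i. f i - c * g i) = bilin n B h f - c * bilin n B h g"
  by (simp add: bilin_def algebra_simps sum_subtractf sum_distrib_left)

lemma bilin_scale: "bilin n B (\<lambda>i. c * f i) (\<lambda>i. c * f i) = c\<^sup>2 * bilin n B f f"
  by (simp add: bilin_def algebra_simps sum_distrib_left power2_eq_square)

lemma bilin_diag:
  "bilin n (\<lambda>i j. B i j - (if i = j then \<mu> else 0)) f f = bilin n B f f - \<mu> * (\<Sum>i<n. (f i)\<^sup>2)"
proof -
  have "(\<Sum>j<n. (B i j - (if i = j then \<mu> else 0)) * f j) = (\<Sum>j<n. B i j * f j) - \<mu> * f i" if "i < n" for i
  proof -
    have "(\<Sum>j<n. (B i j - (if i = j then \<mu> else 0)) * f j)
        = (\<Sum>j<n. B i j * f j) - (\<Sum>j<n. if i = j then \<mu> * f j else 0)"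
      unfolding sum_subtractf[symmetric] by (intro sum.cong) (auto simp: algebra_simps)
    then show ?thesis using that by simp
  qed
  then have "bilin n (\<lambda>i j. B i j - (if i = j then \<mu> else 0)) f f
      = (\<Sum>i<n. f i * ((\<Sum>j<n. B i j * f j) - \<mu> * f i))"
    unfolding bilin_def by (intro sum.cong) auto
  then show ?thesis
    unfolding bilin_def
    by (simp add: right_diff_distrib sum_subtractf sum_distrib_left power2_eq_square mult.left_commute)
qed

lemma abs_le_1_if_unit:
  fixes f :: "nat \<Rightarrow> real"
  assumes "(\<Sum>i<n. (f i)\<^sup>2) = 1" "i < n"
  shows "\<bar>f i\<bar> \<le> 1"
proof -
  have "(f i)\<^sup>2 \<le> (\<Sum>i<n. (f i)\<^sup>2)"
    by (rule member_le_sum) (use assms in auto)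
  then show ?thesis using assms by (simp add: abs_square_le_1)
qed

lemma abs_bilin_le:
  assumes "\<And>i. i < n \<Longrightarrow> \<bar>f i\<bar> \<le> 1" "\<And>i. i < n \<Longrightarrow> \<bar>g i\<bar> \<le> 1"
  shows "\<bar>bilin n B f g\<bar> \<le> (\<Sum>i<n. \<Sum>j<n. \<bar>B i j\<bar>)"
  unfolding bilin_def sum_distrib_left
proof (intro order_trans[OF sum_abs] sum_mono)
  fix i j assume "i \<in> {..<n}" "j \<in> {..<n}"
  then have "\<bar>f i\<bar> * (\<bar>B i j\<bar> * \<bar>g j\<bar>) \<le> 1 * (\<bar>B i j\<bar> * 1)"
    using assms by (intro mult_mono) auto
  then show "\<bar>f i * (B i j * g j)\<bar> \<le> \<bar>B i j\<bar>" by (simp add: abs_mult)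
qed

text \<open>If \<open>B\<close> is positive semidefinite with right inverse \<open>C\<close>, testing positivity at
  \<open>f - C f / M\<close> bounds \<open>B\<close> away from zero on the unit sphere.\<close>

lemma coercive_of_right_inverse:
  assumes sym: "\<And>i j. i < n \<Longrightarrow> j < n \<Longrightarrow> B i j = B j i"
    and psd: "\<And>f. bilin n B f f \<ge> 0"
    and inv: "\<And>i k. i < n \<Longrightarrow> k < n \<Longrightarrow> (\<Sum>j<n. B i j * C j k) = (if i = k then 1 else 0)"
  shows "\<exists>c>0. \<forall>f. (\<Sum>i<n. (f i)\<^sup>2) = 1 \<longrightarrow> bilin n B f f \<ge> c"
proof -
  \<comment> \<open>The summand 1 keeps \<open>M\<close> positive; the rest bounds the quadratic
    form of \<open>C\<close> on the unit sphere.\<close>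
  define M where "M = 1 + (\<Sum>i<n. \<Sum>j<n. \<bar>C i j\<bar>)"
  have M: "M > 0" by (auto simp: M_def intro!: add_pos_nonneg sum_nonneg)
  have "bilin n B f f \<ge> 1 / M" if f: "(\<Sum>i<n. (f i)\<^sup>2) = 1" for f
  proof -
    define g where "g j = (\<Sum>k<n. C j k * f k)" for j
    have Bg: "(\<Sum>j<n. B i j * g j) = f i" if i: "i < n" for i
    proof -
      have "(\<Sum>j<n. B i j * g j) = (\<Sum>j<n. \<Sum>k<n. B i j * C j k * f k)"
        by (simp add: g_def sum_distrib_left mult.assoc)
      also have "\<dots> = (\<Sum>k<n. (\<Sum>j<n. B i j * C j k) * f k)"
        by (subst sum.swap) (simp add: sum_distrib_right)
      also have "\<dots> = (\<Sum>k<n. if i = k then f k else 0)"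
        using inv i by (intro sum.cong) auto
      finally show ?thesis using i by simp
    qed
    have fg: "bilin n B f g = 1"
      using Bg f by (simp add: bilin_def power2_eq_square)
    have "bilin n B g g = bilin n C f f"
    proof -
      have "bilin n B g g = (\<Sum>i<n. g i * f i)" using Bg by (simp add: bilin_def)
      then show ?thesis by (simp add: bilin_def g_def mult.commute)
    qed
    then have gg: "bilin n B g g \<le> M"
      using abs_bilin_le[of n f f C] abs_le_1_if_unit[OF f] by (simp add: M_def)
    have gf: "bilin n B g f = 1"
      unfolding fg[symmetric] by (rule bilin_commute) (rule sym)
    have "0 \<le> bilin n B (\<lambda>i. f i - (1 / M) * g i) (\<lambda>i. f i - (1 / M) * g i)" by (rule psd)
    also have "\<dots> = bilin n B f f - 2 / M + bilin n B g g / M\<^sup>2"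
      unfolding bilin_diff_scale_left bilin_diff_scale_right fg gf
      by (simp add: power2_eq_square diff_divide_distrib)
    also have "\<dots> \<le> bilin n B f f - 2 / M + M / M\<^sup>2"
      using gg by (intro add_left_mono divide_right_mono) auto
    also have "\<dots> = bilin n B f f - 1 / M"
      using M by (simp add: power2_eq_square)
    finally show ?thesis by simp
  qed
  then show ?thesis using M by (intro exI[of _ "1 / M"]) auto
qed

text \<open>Take \<open>\<mu>\<close> as the infimum of the form on the unit sphere. If it were not
  an eigenvalue, A - \<open>\<mu>\<close> I would be invertible and positive semidefinite, hence
  uniformly positive on the sphere, and the infimum would be larger. The argument needs neither
  compactness nor diagonalization.\<close>

lemma symmetric_min_eigenvalue:
  fixes A :: "real mat"
  assumes A: "A \<in> carrier_mat n n" and n: "n \<ge> 1"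
    and sym: "\<And>i j. i < n \<Longrightarrow> j < n \<Longrightarrow> A $$ (i, j) = A $$ (j, i)"
  obtains \<mu> where "eigenvalue A \<mu>"
    "\<And>f. \<mu> * (\<Sum>i<n. (f i)\<^sup>2) \<le> bilin n (\<lambda>i j. A $$ (i, j)) f f"
proof -
  define a where "a = (\<lambda>i j. A $$ (i, j))"
  define Q where "Q = {bilin n a f f | f. (\<Sum>i<n. (f i)\<^sup>2) = 1}"
  define \<mu> where "\<mu> = Inf Q"
  \<comment> \<open>The first basis vector shows that the set of values is non-empty.\<close>
  define e where "e i = (if i = 0 then 1 else 0 :: real)" for i :: nat
  have "(\<Sum>i<n. (e i)\<^sup>2) = (\<Sum>i<n. if i = 0 then 1 else 0)"
    by (intro sum.cong) (auto simp: e_def)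
  then have "(\<Sum>i<n. (e i)\<^sup>2) = 1" using n by simp
  then have "bilin n a e e \<in> Q" unfolding Q_def by (intro CollectI exI[of _ e] conjI refl)
  then have Q_ne: "Q \<noteq> {}" by (rule ex_in_conv[THEN iffD1, OF exI])
  have lower: "- (\<Sum>i<n. \<Sum>j<n. \<bar>a i j\<bar>) \<le> bilin n a f f" if "(\<Sum>i<n. (f i)\<^sup>2) = 1" for f
    using abs_bilin_le[of n f f a] abs_le_1_if_unit[OF that] by (simp add: abs_le_iff)
  have Q_bdd: "bdd_below Q"
    by (rule bdd_belowI[of _ "- (\<Sum>i<n. \<Sum>j<n. \<bar>a i j\<bar>)"]) (use lower in \<open>auto simp only: Q_def mem_Collect_eq\<close>)
  have ray: "\<mu> * (\<Sum>i<n. (f i)\<^sup>2) \<le> bilin n a f f" for f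
  proof (cases "(\<Sum>i<n. (f i)\<^sup>2) = 0")
    case True
    then have "f i = 0" if "i < n" for i using that by (simp add: sum_nonneg_eq_0_iff)
    then have "bilin n a f f = 0" by (simp add: bilin_def)
    then show ?thesis using True by simp
  next
    case False
    define s where "s = sqrt (\<Sum>i<n. (f i)\<^sup>2)"
    have s: "s > 0" "s\<^sup>2 = (\<Sum>i<n. (f i)\<^sup>2)"
      using False sum_nonneg[of "{..<n}" "\<lambda>i. (f i)\<^sup>2"] by (auto simp: s_def)
    have "(\<Sum>i<n. ((1 / s) * f i)\<^sup>2) = (1 / s)\<^sup>2 * (\<Sum>i<n. (f i)\<^sup>2)"
      by (simp only: power_mult_distrib sum_distrib_left)
    also have "\<dots> = 1" using s by (simp add: power_divide flip: s(2))
    finally have "bilin n a (\<lambda>i. (1 / s) * f i) (\<lambda>i. (1 / s) * f i) \<in> Q"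
      unfolding Q_def by (intro CollectI exI[of _ "\<lambda>i. (1 / s) * f i"] conjI refl)
    then have "\<mu> \<le> (1 / s)\<^sup>2 * bilin n a f f"
      unfolding \<mu>_def using cInf_lower[OF _ Q_bdd] by (simp only: bilin_scale)
    then have "s\<^sup>2 * \<mu> \<le> s\<^sup>2 * ((1 / s)\<^sup>2 * bilin n a f f)" by (rule mult_left_mono) simp
    also have "\<dots> = bilin n a f f" using s(1) by (simp add: power_divide)
    finally show ?thesis unfolding s(2) by (simp only: mult.commute)
  qed
  have "eigenvalue A \<mu>"
  proof (rule ccontr)
    assume "\<not> eigenvalue A \<mu>"
    then have "det (char_matrix A \<mu>) \<noteq> 0" using eigenvalue_det[OF A] by simp
    \<comment> \<open>\<open>char_matrix A \<mu>\<close> is A - \<open>\<mu>\<close> I; its right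
      inverse is what \<open>coercive_of_right_inverse\<close> needs.\<close>
    from det_non_zero_imp_unit[OF char_matrix_closed[OF A] this, of "()"]
    obtain C where C: "C \<in> carrier_mat n n" and inv: "char_matrix A \<mu> * C = 1\<^sub>m n"
      by (auto simp: Units_def ring_mat_def)
    define b where "b = (\<lambda>i j. a i j - (if i = j then \<mu> else 0))"
    have cm: "char_matrix A \<mu> $$ (i, j) = b i j" if "i < n" "j < n" for i j
      using that A by (auto simp: char_matrix_def a_def b_def)
    have bC: "(\<Sum>j<n. b i j * C $$ (j, k)) = (if i = k then 1 else 0)" if "i < n" "k < n" for i k
    proof -
      have "(char_matrix A \<mu> * C) $$ (i, k) = (\<Sum>j<n. char_matrix A \<mu> $$ (i, j) * C $$ (j, k))"
        using that C char_matrix_closed[OF A, of \<mu>] by (auto simp: scalar_prod_def lessThan_atLeast0)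
      also have "\<dots> = (\<Sum>j<n. b i j * C $$ (j, k))"
        using cm that(1) by (intro sum.cong) auto
      finally show ?thesis using that by (simp add: inv)
    qed
    have "\<exists>c>0. \<forall>f. (\<Sum>i<n. (f i)\<^sup>2) = 1 \<longrightarrow> bilin n b f f \<ge> c"
    proof (rule coercive_of_right_inverse[OF _ _ bC])
      show "b i j = b j i" if "i < n" "j < n" for i j using sym that by (simp add: b_def a_def)
      show "bilin n b f f \<ge> 0" for f using ray[of f] by (simp add: b_def bilin_diag)
    qed
    then obtain c where c: "c > 0" "\<And>f. (\<Sum>i<n. (f i)\<^sup>2) = 1 \<Longrightarrow> bilin n a f f - \<mu> \<ge> c"
      unfolding b_def bilin_diag by fastforce
    have "\<mu> + c \<le> Inf Q"
      using c(2) by (intro cInf_greatest[OF Q_ne]) (force simp: Q_def)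
    then show False using c(1) by (simp add: \<mu>_def)
  qed
  then show ?thesis using ray unfolding a_def by (rule that)
qed

text \<open>Eigenvalues are roots of the monic characteristic polynomial. Finiteness makes
  \<open>Min\<close> and \<open>Max\<close> in \<open>lambda_min\<close> and
  \<open>cond_number\<close> genuine extrema.\<close>

lemma finite_eigenvalues:
  fixes A :: "real mat"
  assumes "A \<in> carrier_mat n n"
  shows "finite {k. eigenvalue A k}"
proof -
  have "char_poly A \<noteq> 0"
    using degree_monic_char_poly[OF assms] by (metis coeff_0 zero_neq_one)
  then show ?thesis
    using eigenvalue_root_char_poly[OF assms] poly_roots_finite by auto
qed

text \<open>The eigenvalue that bounds the form from below is itself at least the smallest one. This
  supplies \<open>coercive\<close> for H(0).\<close>

lemma lambda_min_le_bilin: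
  assumes A: "A \<in> carrier_mat n n" and n: "n \<ge> 1"
    and sym: "\<And>i j. i < n \<Longrightarrow> j < n \<Longrightarrow> A $$ (i, j) = A $$ (j, i)"
  shows "lambda_min A * (\<Sum>i<n. (f i)\<^sup>2) \<le> bilin n (\<lambda>i j. A $$ (i, j)) f f"
proof -
  obtain \<mu> where \<mu>: "eigenvalue A \<mu>" "\<And>f. \<mu> * (\<Sum>i<n. (f i)\<^sup>2) \<le> bilin n (\<lambda>i j. A $$ (i, j)) f f"
    using symmetric_min_eigenvalue[OF A n sym] by blast
  have "lambda_min A \<le> \<mu>"
    unfolding lambda_min_def using \<mu>(1) finite_eigenvalues[OF A] by (intro Min_le) auto
  then have "lambda_min A * (\<Sum>i<n. (f i)\<^sup>2) \<le> \<mu> * (\<Sum>i<n. (f i)\<^sup>2)"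
    by (intro mult_right_mono sum_nonneg) auto
  with \<mu>(2)[of f] show ?thesis by linarith
qed

text \<open>For singular \<open>A\<close> the quotient is \<open>x / 0 = 0\<close>.\<close>

lemma cond_number_cases:
  fixes A :: "real mat"
  assumes A: "A \<in> carrier_mat n n" and n: "n \<ge> 1"
  shows "cond_number A \<le> 0 \<or> cond_number A \<ge> 1"
proof -
  define T where "T = sqrt ` {k. eigenvalue (transpose_mat A * A) k}"
  have C: "transpose_mat A * A \<in> carrier_mat n n" using A by auto
  have sym: "(transpose_mat A * A) $$ (i, j) = (transpose_mat A * A) $$ (j, i)" if "i < n" "j < n" for i j
    using that A by (simp add: scalar_prod_def mult.commute)
  obtain \<mu> where "eigenvalue (transpose_mat A * A) \<mu>"
    using symmetric_min_eigenvalue[OF C n sym] by blast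
  then have T: "T \<noteq> {}" "finite T"
    using finite_eigenvalues[OF C] by (auto simp: T_def)
  show ?thesis
  proof (cases "Min T > 0")
    case True
    have "Min T \<le> Max T" using T by simp
    then show ?thesis using True by (simp add: cond_number_def T_def[symmetric])
  next
    case False
    \<comment> \<open>From k |v|^2 = |A v|^2. A least singular value that is not positive is
      therefore 0, and the quotient is 0.\<close>
    have "k \<ge> 0" if k: "eigenvalue (transpose_mat A * A) k" for k
    proof -
      obtain v where v: "v \<in> carrier_vec n" "v \<noteq> 0\<^sub>v n" "(transpose_mat A * A) *\<^sub>v v = k \<cdot>\<^sub>v v"
        using k C by (auto simp: eigenvalue_def eigenvector_def)
      have "k * (v \<bullet> v) = v \<bullet> ((transpose_mat A * A) *\<^sub>v v)"
        unfolding v(3) using v(1) by simp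
      also have "\<dots> = v \<bullet> (transpose_mat A *\<^sub>v (A *\<^sub>v v))"
        using v(1) A by (subst assoc_mult_mat_vec[of _ n n _ n]) auto
      also have "\<dots> = (A *\<^sub>v v) \<bullet> (A *\<^sub>v v)"
        using v(1) A by (subst comm_scalar_prod[of _ n]) (auto intro!: transpose_vec_mult_scalar[of _ n n])
      finally have "k * (v \<bullet> v) \<ge> 0" by (simp add: scalar_prod_def sum_nonneg)
      moreover have "v \<bullet> v > 0"
      proof -
        obtain i where "i < n" "v $ i \<noteq> 0" using v(1,2) by (metis carrier_vecD eq_vecI index_zero_vec(1,2))
        then show ?thesis
          using v(1) by (auto simp: scalar_prod_def intro!: sum_pos2[of _ i] simp: zero_less_mult_iff neq_iff)
      qed
      ultimately show ?thesis by (simp add: zero_le_mult_iff)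
    qed
    then have "Min T \<ge> 0" using T by (auto simp: T_def)
    then show ?thesis using False by (simp add: cond_number_def T_def[symmetric])
  qed
qed

section \<open>Concentration at initialization\<close>

lemma sets_std_gauss [measurable_cong, simp]: "sets std_gauss = sets borel"
  by (simp add: std_gauss_def)

lemma space_std_gauss [simp]: "space std_gauss = UNIV"
  by (simp add: std_gauss_def)

lemma measurable_to_std_gauss: "measurable M std_gauss = borel_measurable M"
  by (rule measurable_cong_sets) auto

lemma prob_space_std_gauss: "prob_space std_gauss"
  unfolding std_gauss_def by (rule prob_space_normal_density) simp

lemma prob_space_rademacher: "prob_space rademacher"
  unfolding rademacher_def by (rule measure_pmf.prob_space_axioms)

lemma sets_rademacher [simp]: "sets rademacher = UNIV"
  by (simp add: rademacher_def)

lemma space_rademacher [simp]: "space rademacher = UNIV"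
  by (simp add: rademacher_def)

abbreviation gauss_vec :: "nat \<Rightarrow> (nat \<Rightarrow> real) measure" where
  "gauss_vec d \<equiv> PiM {..<d} (\<lambda>_. std_gauss)"

abbreviation gauss_weights :: "nat \<Rightarrow> nat \<Rightarrow> (nat \<Rightarrow> nat \<Rightarrow> real) measure" where
  "gauss_weights d m \<equiv> PiM {..<m} (\<lambda>_. gauss_vec d)"

abbreviation signs :: "nat \<Rightarrow> (nat \<Rightarrow> real) measure" where
  "signs m \<equiv> PiM {..<m} (\<lambda>_. rademacher)"

lemma prob_space_gauss_vec: "prob_space (gauss_vec d)"
  by (intro prob_space_PiM prob_space_std_gauss)

lemma prob_space_gauss_weights: "prob_space (gauss_weights d m)"
  by (intro prob_space_PiM prob_space_gauss_vec)

lemma prob_space_signs: "prob_space (signs m)"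
  by (intro prob_space_PiM prob_space_rademacher)

lemma prob_space_init_measure: "prob_space (init_measure d m)"
  unfolding init_measure_def
  by (intro prob_space_pair prob_space_gauss_weights prob_space_signs)

lemma measurable_dotp [measurable]: "(\<lambda>v. dotp d v x) \<in> borel_measurable (gauss_vec d)"
  unfolding dotp_def
proof (rule borel_measurable_sum)
  fix k assume "k \<in> {..<d}"
  then have "(\<lambda>v. v k) \<in> measurable (gauss_vec d) std_gauss" by (rule measurable_component_singleton)
  then have [measurable]: "(\<lambda>v. v k) \<in> borel_measurable (gauss_vec d)"
    by (simp only: measurable_to_std_gauss)
  show "(\<lambda>v. v k * x k) \<in> borel_measurable (gauss_vec d)" by measurable
qed

lemma measurable_dotp_weights:
  assumes "r < m"
  shows "(\<lambda>u. dotp d (u r) x) \<in> borel_measurable (gauss_weights d m)"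
proof -
  have "(\<lambda>u. u r) \<in> measurable (gauss_weights d m) (gauss_vec d)"
    using assms by (intro measurable_component_singleton) auto
  then show ?thesis by (rule measurable_compose[OF _ measurable_dotp])
qed

lemma measurable_sign:
  assumes "r < m"
  shows "(\<lambda>a. a r) \<in> borel_measurable (signs m)"
proof -
  have "(\<lambda>a. a r) \<in> measurable (signs m) rademacher"
    using assms by (intro measurable_component_singleton) auto
  moreover have "(\<lambda>b. b) \<in> measurable rademacher borel"
    by (simp add: measurable_def)
  ultimately show ?thesis by (rule measurable_compose)
qed

lemma measurable_init_dotp:
  assumes "r < m"
  shows "(\<lambda>p. dotp d (fst p r) x) \<in> borel_measurable (init_measure d m)"
  unfolding init_measure_def
  by (rule measurable_compose[OF measurable_fst measurable_dotp_weights[OF assms]])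

lemma measurable_init_sign:
  assumes "r < m"
  shows "(\<lambda>p. snd p r) \<in> borel_measurable (init_measure d m)"
  unfolding init_measure_def
  by (rule measurable_compose[OF measurable_snd measurable_sign[OF assms]])

lemma measurable_relu [measurable]: "relu \<in> borel_measurable borel"
  unfolding relu_def by measurable

lemma measurable_init_net:
  "(\<lambda>p. net d m (snd p) (fst p) x) \<in> borel_measurable (init_measure d m)"
  unfolding net_def
  by (intro borel_measurable_times borel_measurable_const borel_measurable_sum
      measurable_compose[OF measurable_init_dotp measurable_relu] measurable_init_sign) auto

text \<open>The projection is a sum of independent centred normals with variances (x k)^2, hence
  normal with variance |x|^2 = 1.\<close>

lemma distr_dotp_gauss_vec:
  assumes x: "dotp d x x = 1"
  shows "distr (gauss_vec d) borel (\<lambda>v. dotp d v x) = std_gauss"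
proof -
  interpret prob_space "gauss_vec d" by (rule prob_space_gauss_vec)
  \<comment> \<open>Coordinates with x k = 0 are dropped: their summand would have standard
    deviation 0, for which there is no normal density.\<close>
  define J where "J = {k. k < d \<and> x k \<noteq> 0}"
  have J: "J \<subseteq> {..<d}" "finite J" by (auto simp: J_def)
  have sumJ: "(\<Sum>k<d. f k * x k) = (\<Sum>k\<in>J. f k * x k)" for f
    by (rule sum.mono_neutral_right) (auto simp: J_def)
  have J_ne: "J \<noteq> {}" using x sumJ[of x] by (auto simp: dotp_def)
  then have d: "{..<d} \<noteq> {}" using J by auto
  have comp: "(\<lambda>v. v k) \<in> measurable (gauss_vec d) borel" if "k < d" for k
  proof -
    have "(\<lambda>v. v k) \<in> measurable (gauss_vec d) std_gauss"
      using that by (intro measurable_component_singleton) auto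
    then show ?thesis by (simp only: measurable_to_std_gauss)
  qed
  have distr: "distr (gauss_vec d) borel (\<lambda>v. v k) = std_gauss" if "k < d" for k
    using distr_PiM_component[of "{..<d}" "\<lambda>_. std_gauss" k] that prob_space_std_gauss
    by (simp cong: distr_cong)
  \<comment> \<open>The joint law of the coordinates is the product measure itself, so it equals the
    product of its marginals.\<close>
  have "indep_vars (\<lambda>_. borel) (\<lambda>k v. v k) {..<d}"
  proof (subst indep_vars_iff_distr_eq_PiM'[OF d])
    have "distr (gauss_vec d) (PiM {..<d} (\<lambda>_. borel)) (\<lambda>v. \<lambda>k\<in>{..<d}. v k)
        = distr (gauss_vec d) (gauss_vec d) (\<lambda>v. v)"
      by (rule distr_cong) (auto simp: space_PiM PiE_def extensional_restrict intro!: sets_PiM_cong)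
    also have "\<dots> = gauss_vec d" by simp
    also have "\<dots> = PiM {..<d} (\<lambda>k. distr (gauss_vec d) borel (\<lambda>v. v k))"
      using distr by (intro PiM_cong) auto
    finally show "distr (gauss_vec d) (PiM {..<d} (\<lambda>_. borel)) (\<lambda>v. \<lambda>k\<in>{..<d}. v k)
        = PiM {..<d} (\<lambda>k. distr (gauss_vec d) borel (\<lambda>v. v k))" .
  qed (use comp in auto)
  then have "indep_vars (\<lambda>_. borel) (\<lambda>k v. v k) J" by (rule indep_vars_subset) (rule J)
  then have indep: "indep_vars (\<lambda>_. borel) (\<lambda>k v. v k * x k) J"
    by (rule indep_vars_compose2) auto
  have "distributed (gauss_vec d) lborel (\<lambda>v. \<Sum>k\<in>J. v k * x k)
      (normal_density (\<Sum>k\<in>J. 0) (sqrt (\<Sum>k\<in>J. \<bar>x k\<bar>\<^sup>2)))"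
  proof (rule sum_indep_normal[OF J(2) J_ne indep])
    fix k assume k: "k \<in> J"
    then show "0 < \<bar>x k\<bar>" by (simp add: J_def)
    have "distr (gauss_vec d) lborel (\<lambda>v. v k) = distr (gauss_vec d) borel (\<lambda>v. v k)"
      by (rule distr_cong) auto
    then have "distributed (gauss_vec d) lborel (\<lambda>v. v k) (normal_density 0 1)"
      using comp[of k] distr[of k] k J by (auto simp: distributed_def std_gauss_def)
    from normal_density_affine[OF this, of "x k" 0] k
    show "distributed (gauss_vec d) lborel (\<lambda>v. v k * x k) (normal_density 0 \<bar>x k\<bar>)"
      by (simp add: J_def mult.commute)
  qed
  moreover have "(\<Sum>k\<in>J. \<bar>x k\<bar>\<^sup>2) = 1"
    using x sumJ[of x] by (simp add: dotp_def power2_eq_square)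
  ultimately have "distributed (gauss_vec d) lborel (\<lambda>v. dotp d v x) (normal_density 0 1)"
    by (simp add: dotp_def sumJ)
  moreover have "distr (gauss_vec d) lborel (\<lambda>v. dotp d v x) = distr (gauss_vec d) borel (\<lambda>v. dotp d v x)"
    by (rule distr_cong) auto
  ultimately show ?thesis by (simp add: distributed_def std_gauss_def)
qed

text \<open>Neurons are independent and their projections on a unit vector are standard normal, so
  expectations of products reduce to the m-th power of a one-dimensional integral.\<close>

lemma nn_integral_gauss_weights_prod:
  assumes x: "dotp d x x = 1" and f [measurable]: "f \<in> borel_measurable borel"
  shows "(\<integral>\<^sup>+u. (\<Prod>r<m. f (dotp d (u r) x)) \<partial>gauss_weights d m) = (\<integral>\<^sup>+g. f g \<partial>std_gauss) ^ m"
proof -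
  interpret product_sigma_finite "\<lambda>_::nat. gauss_vec d"
    using prob_space_gauss_vec
    by (simp add: product_sigma_finite_def prob_space_imp_sigma_finite)
  have "(\<integral>\<^sup>+u. (\<Prod>r<m. f (dotp d (u r) x)) \<partial>gauss_weights d m)
      = (\<Prod>r<m. \<integral>\<^sup>+v. f (dotp d v x) \<partial>gauss_vec d)"
    by (rule product_nn_integral_prod) auto
  also have "(\<integral>\<^sup>+v. f (dotp d v x) \<partial>gauss_vec d) = (\<integral>\<^sup>+g. f g \<partial>distr (gauss_vec d) borel (\<lambda>v. dotp d v x))"
    by (rule nn_integral_distr[symmetric]) auto
  finally show ?thesis by (simp add: distr_dotp_gauss_vec[OF x])
qed

section \<open>One-dimensional Gaussian estimates\<close>

lemma nn_integral_std_gauss: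
  assumes [measurable]: "f \<in> borel_measurable borel"
  shows "(\<integral>\<^sup>+g. f g \<partial>std_gauss) = (\<integral>\<^sup>+g. ennreal (std_normal_density g) * f g \<partial>lborel)"
  unfolding std_gauss_def by (rule nn_integral_density) auto

lemma nn_integral_std_gauss_exp: "(\<integral>\<^sup>+g. ennreal (exp (z * g)) \<partial>std_gauss) = ennreal (exp (z\<^sup>2 / 2))"
proof -
  \<comment> \<open>Completing the square: the exponential tilt shifts the mean to z.\<close>
  have eq: "std_normal_density g * exp (z * g) = exp (z\<^sup>2 / 2) * normal_density z 1 g" for g
    by (simp add: normal_density_def exp_add[symmetric] power2_eq_square algebra_simps diff_divide_distrib add_divide_distrib)
  have "(\<integral>\<^sup>+g. ennreal (exp (z * g)) \<partial>std_gauss)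
      = (\<integral>\<^sup>+g. ennreal (exp (z\<^sup>2 / 2)) * ennreal (normal_density z 1 g) \<partial>lborel)"
    by (subst nn_integral_std_gauss) (auto simp: ennreal_mult'[symmetric] eq)
  also have "\<dots> = ennreal (exp (z\<^sup>2 / 2)) * (\<integral>\<^sup>+g. ennreal (normal_density z 1 g) \<partial>lborel)"
    by (rule nn_integral_cmult) auto
  also have "(\<integral>\<^sup>+g. ennreal (normal_density z 1 g) \<partial>lborel) = 1"
    by (subst nn_integral_eq_integral) auto
  finally show ?thesis by simp
qed

text \<open>The density is at most 1 / 2 because 2 pi is at least 4, and the interval has length 2
  R. This is why few neurons start close to the kink.\<close>

lemma std_gauss_Icc_le:
  assumes "R \<ge> 0"
  shows "emeasure std_gauss {-R..R} \<le> ennreal R"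
proof -
  have dens: "std_normal_density g \<le> 1 / 2" for g
  proof -
    have "sqrt 4 \<le> sqrt (2 * pi)" using pi_gt3 by (intro real_sqrt_le_mono) linarith
    then have "2 \<le> sqrt (2 * pi)" by simp
    then have "1 / sqrt (2 * pi) * exp (- g\<^sup>2 / 2) \<le> 1 / 2 * 1"
      by (intro mult_mono) (auto simp: field_simps)
    then show ?thesis by (simp add: std_normal_density_def)
  qed
  have "emeasure std_gauss {-R..R} = (\<integral>\<^sup>+g. ennreal (std_normal_density g) * indicator {-R..R} g \<partial>lborel)"
    unfolding std_gauss_def by (rule emeasure_density) auto
  also have "\<dots> \<le> (\<integral>\<^sup>+g. ennreal (1 / 2) * indicator {-R..R} g \<partial>lborel)"
    by (intro nn_integral_mono mult_right_mono ennreal_leI dens) auto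
  also have "\<dots> = ennreal (1 / 2) * emeasure lborel {-R..R}"
    by (rule nn_integral_cmult_indicator) simp
  also have "\<dots> = ennreal (1 / 2) * ennreal (2 * R)" using assms by simp
  also have "\<dots> = ennreal (1 / 2 * (2 * R))" by (rule ennreal_mult'[symmetric]) simp
  also have "\<dots> = ennreal R" by simp
  finally show ?thesis .
qed

text \<open>By symmetry both half-lines have the same mass, and 0 is not an atom.\<close>

lemma std_gauss_negative: "emeasure std_gauss {..<0} = ennreal (1 / 2)"
proof -
  interpret prob_space std_gauss by (rule prob_space_std_gauss)
  have "emeasure std_gauss {0<..} = (\<integral>\<^sup>+g. ennreal (std_normal_density g) * indicator {0<..} g \<partial>lborel)"
    unfolding std_gauss_def by (rule emeasure_density) auto
  also have "\<dots> = (\<integral>\<^sup>+g. ennreal (std_normal_density (-g)) * indicator {0<..} (-g) \<partial>lborel)"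
    by (subst nn_integral_real_affine[where c = "-1" and t = 0]) auto
  also have "\<dots> = (\<integral>\<^sup>+g. ennreal (std_normal_density g) * indicator {..<0} g \<partial>lborel)"
    by (intro nn_integral_cong) (auto simp: normal_density_def indicator_def)
  also have "\<dots> = emeasure std_gauss {..<0}"
    unfolding std_gauss_def by (rule emeasure_density[symmetric]) auto
  finally have sym: "prob {0<..} = prob {..<0}" by (simp add: emeasure_eq_measure)
  have "emeasure std_gauss {0} = 0"
    using std_gauss_Icc_le[of 0] by simp
  then have zero: "prob {0} = 0" by (simp add: emeasure_eq_measure)
  have "prob UNIV = prob ({..<0} \<union> ({0} \<union> {0<..}))"
    by (rule arg_cong[where f = prob]) auto
  also have "\<dots> = prob {..<0} + prob ({0} \<union> {0<..})"
    by (rule finite_measure_Union) auto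
  also have "prob ({0} \<union> {0<..}) = prob {0} + prob {0<..}"
    by (rule finite_measure_Union) auto
  finally have "prob {..<0} = 1 / 2"
    using sym zero prob_space by simp
  then show ?thesis by (simp only: emeasure_eq_measure)
qed

section \<open>Chernoff bound for the number of neurons with preactivation in a given set\<close>

lemma measurable_card_init:
  assumes [measurable]: "B \<in> sets borel"
  shows "(\<lambda>p. real (card {r. r < m \<and> dotp d (fst p r) x \<in> B})) \<in> borel_measurable (init_measure d m)"
proof -
  have card: "real (card {r. r < m \<and> dotp d (u r) x \<in> B}) = (\<Sum>r<m. indicator B (dotp d (u r) x))" for u
  proof -
    have "{r. r < m \<and> dotp d (u r) x \<in> B} = {r \<in> {..<m}. dotp d (u r) x \<in> B}" by auto
    then show ?thesis by (simp add: indicator_def sum.If_cases Int_def)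
  qed
  show ?thesis unfolding card
    by (intro borel_measurable_sum measurable_compose[OF measurable_init_dotp]) auto
qed

lemma prob_init_fst:
  assumes "A \<in> sets (gauss_weights d m)"
  shows "measure (init_measure d m) {p \<in> space (init_measure d m). fst p \<in> A} = measure (gauss_weights d m) A"
proof -
  interpret S: prob_space "signs m" by (rule prob_space_signs)
  interpret G: prob_space "gauss_weights d m" by (rule prob_space_gauss_weights)
  have "{p \<in> space (init_measure d m). fst p \<in> A} = A \<times> space (signs m)"
    using sets.sets_into_space[OF assms] by (auto simp: init_measure_def space_pair_measure)
  then show ?thesis
    unfolding init_measure_def using assms S.emeasure_space_1
    by (simp add: measure_def S.emeasure_pair_measure_Times)
qed

text \<open>Markov's inequality for exp (\<open>\<theta>\<close> times the count). Each indicator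
  contributes at most 1 + (\<open>\<theta>\<close> + \<open>\<theta>\<close>^2) p to the product,
  since exp \<open>\<theta>\<close> is at most 1 + \<open>\<theta>\<close> +
  \<open>\<theta>\<close>^2 on [0, 1]. The signs are integrated out through
  \<open>prob_init_fst\<close>.\<close>

lemma prob_card_ge:
  fixes \<theta> k p :: real
  assumes x: "dotp d x x = 1" and B [measurable]: "B \<in> sets borel"
    and p: "emeasure std_gauss B \<le> ennreal p" "p \<ge> 0" and \<theta>: "0 \<le> \<theta>" "\<theta> \<le> 1"
  shows "measure (init_measure d m) {q \<in> space (init_measure d m). k \<le> real (card {r. r < m \<and> dotp d (fst q r) x \<in> B})}
    \<le> exp (real m * p * (\<theta> + \<theta>\<^sup>2) - \<theta> * k)"
proof -
  interpret G: prob_space "gauss_weights d m" by (rule prob_space_gauss_weights)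
  define c where "c u = real (card {r. r < m \<and> dotp d (u r) x \<in> B})" for u
  have card: "c u = (\<Sum>r<m. indicator B (dotp d (u r) x))" for u
  proof -
    have "{r. r < m \<and> dotp d (u r) x \<in> B} = {r \<in> {..<m}. dotp d (u r) x \<in> B}" by auto
    then show ?thesis by (simp add: c_def indicator_def sum.If_cases Int_def)
  qed
  have c_meas [measurable]: "c \<in> borel_measurable (gauss_weights d m)"
    unfolding card by (intro borel_measurable_sum measurable_compose[OF measurable_dotp_weights]) auto
  define f where "f g = ennreal (exp (\<theta> * indicator B g))" for g :: real
  have f [measurable]: "f \<in> borel_measurable borel" unfolding f_def by measurable
  have "(\<integral>\<^sup>+g. f g \<partial>std_gauss) \<le> (\<integral>\<^sup>+g. 1 + ennreal (\<theta> + \<theta>\<^sup>2) * indicator B g \<partial>std_gauss)"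
  proof (rule nn_integral_mono)
    fix g
    show "f g \<le> 1 + ennreal (\<theta> + \<theta>\<^sup>2) * indicator B g"
    proof (cases "g \<in> B")
      case True
      have "ennreal (exp \<theta>) \<le> ennreal (1 + (\<theta> + \<theta>\<^sup>2))"
        using exp_bound[OF \<theta>] by (intro ennreal_leI) simp
      also have "\<dots> = 1 + ennreal (\<theta> + \<theta>\<^sup>2)"
        using \<theta> by (subst ennreal_plus) auto
      finally show ?thesis using True by (simp add: f_def)
    qed (simp add: f_def)
  qed
  also have "\<dots> = 1 + ennreal (\<theta> + \<theta>\<^sup>2) * emeasure std_gauss B"
    using prob_space.emeasure_space_1[OF prob_space_std_gauss]
    by (subst nn_integral_add) (auto simp: nn_integral_cmult_indicator)
  also have "\<dots> \<le> 1 + ennreal (\<theta> + \<theta>\<^sup>2) * ennreal p"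
    using p by (intro add_left_mono mult_left_mono) auto
  also have "\<dots> = ennreal (1 + (\<theta> + \<theta>\<^sup>2) * p)"
    using p \<theta> by (simp add: ennreal_mult'[symmetric] ennreal_plus[symmetric] ennreal_1[symmetric] del: ennreal_plus ennreal_1)
  also have "\<dots> \<le> ennreal (exp ((\<theta> + \<theta>\<^sup>2) * p))"
    by (intro ennreal_leI) (simp add: exp_ge_add_one_self)
  finally have f_le: "(\<integral>\<^sup>+g. f g \<partial>std_gauss) \<le> ennreal (exp ((\<theta> + \<theta>\<^sup>2) * p))" .
  have "emeasure (gauss_weights d m) {u \<in> space (gauss_weights d m). 1 \<le> ennreal (exp (- \<theta> * k)) * ennreal (exp (\<theta> * c u))}
      \<le> ennreal (exp (- \<theta> * k)) * (\<integral>\<^sup>+u. ennreal (exp (\<theta> * c u)) * indicator (space (gauss_weights d m)) u \<partial>gauss_weights d m)"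
    by (rule nn_integral_Markov_inequality) auto
  also have "(\<integral>\<^sup>+u. ennreal (exp (\<theta> * c u)) * indicator (space (gauss_weights d m)) u \<partial>gauss_weights d m)
      = (\<integral>\<^sup>+u. (\<Prod>r<m. f (dotp d (u r) x)) \<partial>gauss_weights d m)"
  proof (rule nn_integral_cong)
    fix u assume "u \<in> space (gauss_weights d m)"
    have "exp (\<theta> * c u) = (\<Prod>r<m. exp (\<theta> * indicator B (dotp d (u r) x)))"
      unfolding card sum_distrib_left by (rule exp_sum) simp
    then show "ennreal (exp (\<theta> * c u)) * indicator (space (gauss_weights d m)) u = (\<Prod>r<m. f (dotp d (u r) x))"
      using \<open>u \<in> _\<close> by (simp add: f_def prod_ennreal)
  qed
  also have "\<dots> = (\<integral>\<^sup>+g. f g \<partial>std_gauss) ^ m"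
    by (rule nn_integral_gauss_weights_prod[OF x f])
  also have "ennreal (exp (- \<theta> * k)) * \<dots> \<le> ennreal (exp (- \<theta> * k)) * ennreal (exp ((\<theta> + \<theta>\<^sup>2) * p)) ^ m"
    using f_le by (intro mult_left_mono power_mono) auto
  also have "\<dots> = ennreal (exp (- \<theta> * k) * exp ((\<theta> + \<theta>\<^sup>2) * p) ^ m)"
    by (simp add: ennreal_mult' ennreal_power)
  also have "exp (- \<theta> * k) * exp ((\<theta> + \<theta>\<^sup>2) * p) ^ m = exp (real m * p * (\<theta> + \<theta>\<^sup>2) - \<theta> * k)"
    by (simp add: exp_of_nat_mult[symmetric] exp_add[symmetric] algebra_simps)
  finally have "measure (gauss_weights d m) {u \<in> space (gauss_weights d m). 1 \<le> ennreal (exp (- \<theta> * k)) * ennreal (exp (\<theta> * c u))}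
      \<le> exp (real m * p * (\<theta> + \<theta>\<^sup>2) - \<theta> * k)"
    by (simp add: G.emeasure_eq_measure)
  moreover have "measure (gauss_weights d m) {u \<in> space (gauss_weights d m). k \<le> c u}
     \<le> measure (gauss_weights d m) {u \<in> space (gauss_weights d m). 1 \<le> ennreal (exp (- \<theta> * k)) * ennreal (exp (\<theta> * c u))}"
  proof (rule G.finite_measure_mono)
    have "1 \<le> ennreal (exp (- \<theta> * k)) * ennreal (exp (\<theta> * c u))" if "k \<le> c u" for u
    proof -
      have "\<theta> * k \<le> \<theta> * c u" using that \<theta> by (intro mult_left_mono) auto
      then have "1 \<le> exp (- \<theta> * k) * exp (\<theta> * c u)" by (simp add: exp_add[symmetric])
      then show ?thesis by (simp add: ennreal_mult'[symmetric] ennreal_1[symmetric] del: ennreal_1)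
    qed
    then show "{u \<in> space (gauss_weights d m). k \<le> c u} \<subseteq>
        {u \<in> space (gauss_weights d m). 1 \<le> ennreal (exp (- \<theta> * k)) * ennreal (exp (\<theta> * c u))}" by auto
  qed measurable
  moreover have "measure (init_measure d m) {q \<in> space (init_measure d m). k \<le> c (fst q)}
      = measure (gauss_weights d m) {u \<in> space (gauss_weights d m). k \<le> c u}"
  proof -
    have "{q \<in> space (init_measure d m). k \<le> c (fst q)}
        = {q \<in> space (init_measure d m). fst q \<in> {u \<in> space (gauss_weights d m). k \<le> c u}}"
      by (auto simp: init_measure_def space_pair_measure)
    moreover have "{u \<in> space (gauss_weights d m). k \<le> c u} \<in> sets (gauss_weights d m)" by measurable
    ultimately show ?thesis by (simp only: prob_init_fst)
  qed
  ultimately show ?thesis by (simp add: c_def)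
qed

section \<open>Sub-Gaussian tails of the initial output\<close>

lemma nn_integral_rademacher:
  "(\<integral>\<^sup>+b. f b \<partial>rademacher) = (f (-1) + f 1) / 2"
  unfolding rademacher_def
  by (subst nn_integral_pmf_of_set) auto

text \<open>The left side is cosh of z relu g: it equals cosh (z g) for g \<ge> 0 and is 1
  otherwise. Averaging over the sign thus allows ReLU to be replaced by the identity.\<close>

lemma exp_relu_le:
  "(exp (- (z * relu g)) + exp (z * relu g)) / 2 \<le> (exp (- z * g) + exp (z * g)) / (2 :: real)"
proof (cases "g \<ge> 0")
  case False
  have "1 \<le> cosh (z * g)" by (rule cosh_real_ge_1)
  then show ?thesis using False by (simp add: relu_def cosh_def)
qed (simp add: relu_def)

lemma prod_mono_ennreal:
  fixes f g :: "nat \<Rightarrow> ennreal"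
  assumes "\<And>r. f r \<le> g r"
  shows "(\<Prod>r<m. f r) \<le> (\<Prod>r<m. g r)"
  using assms by (induction m) (auto intro: mult_mono)

text \<open>Integrating the signs first replaces ReLU by a linear neuron, whose Gaussian moment is
  exp (z^2 / 2) with z = t / sqrt m. The m factors multiply to exp (t^2 / 2), independently of
  m.\<close>

lemma nn_integral_exp_net:
  assumes x: "dotp d x x = 1" and m: "m \<ge> 1"
  shows "(\<integral>\<^sup>+p. ennreal (exp (t * net d m (snd p) (fst p) x)) \<partial>init_measure d m) \<le> ennreal (exp (t\<^sup>2 / 2))"
proof -
  interpret S: prob_space "signs m" by (rule prob_space_signs)
  interpret R: product_sigma_finite "\<lambda>_::nat. rademacher"
    using prob_space_rademacher
    by (simp add: product_sigma_finite_def prob_space_imp_sigma_finite)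
  define z where "z = t / sqrt (real m)"
  define h where "h g = ennreal ((exp (- z * g) + exp (z * g)) / 2)" for g :: real
  have h [measurable]: "h \<in> borel_measurable borel" unfolding h_def by measurable
  have meas: "(\<lambda>p. ennreal (exp (t * net d m (snd p) (fst p) x))) \<in> borel_measurable (init_measure d m)"
    using measurable_init_net[of d m x] by measurable
  have "(\<integral>\<^sup>+p. ennreal (exp (t * net d m (snd p) (fst p) x)) \<partial>init_measure d m)
      = (\<integral>\<^sup>+u. \<integral>\<^sup>+a. ennreal (exp (t * net d m a u x)) \<partial>signs m \<partial>gauss_weights d m)"
    using S.nn_integral_fst[OF meas[unfolded init_measure_def]] by (simp add: init_measure_def)
  also have "\<dots> \<le> (\<integral>\<^sup>+u. (\<Prod>r<m. h (dotp d (u r) x)) \<partial>gauss_weights d m)"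
  proof (rule nn_integral_mono)
    fix u
    have "exp (t * net d m a u x) = (\<Prod>r<m. exp (z * relu (dotp d (u r) x) * a r))" for a
      by (simp add: net_def z_def sum_distrib_left exp_sum[symmetric] mult.commute mult.left_commute)
    then have "(\<integral>\<^sup>+a. ennreal (exp (t * net d m a u x)) \<partial>signs m)
        = (\<integral>\<^sup>+a. (\<Prod>r<m. ennreal (exp (z * relu (dotp d (u r) x) * a r))) \<partial>signs m)"
      by (simp add: prod_ennreal)
    also have "\<dots> = (\<Prod>r<m. \<integral>\<^sup>+b. ennreal (exp (z * relu (dotp d (u r) x) * b)) \<partial>rademacher)"
      by (rule R.product_nn_integral_prod) (auto simp: measurable_def)
    also have "\<dots> \<le> (\<Prod>r<m. h (dotp d (u r) x))"
    proof (rule prod_mono_ennreal)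
      fix r
      have "(\<integral>\<^sup>+b. ennreal (exp (z * relu (dotp d (u r) x) * b)) \<partial>rademacher)
          = ennreal ((exp (- (z * relu (dotp d (u r) x))) + exp (z * relu (dotp d (u r) x))) / 2)"
        unfolding nn_integral_rademacher
        by (simp add: ennreal_plus[symmetric] divide_ennreal[symmetric] del: ennreal_plus)
      also have "\<dots> \<le> h (dotp d (u r) x)"
        unfolding h_def by (intro ennreal_leI exp_relu_le)
      finally show "(\<integral>\<^sup>+b. ennreal (exp (z * relu (dotp d (u r) x) * b)) \<partial>rademacher) \<le> h (dotp d (u r) x)" .
    qed
    finally show "(\<integral>\<^sup>+a. ennreal (exp (t * net d m a u x)) \<partial>signs m) \<le> (\<Prod>r<m. h (dotp d (u r) x))" .
  qed
  also have "\<dots> = (\<integral>\<^sup>+g. h g \<partial>std_gauss) ^ m"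
    by (rule nn_integral_gauss_weights_prod[OF x h])
  also have "(\<integral>\<^sup>+g. h g \<partial>std_gauss) = ennreal (exp (z\<^sup>2 / 2))"
  proof -
    have "h g = (ennreal (exp ((- z) * g)) + ennreal (exp (z * g))) / 2" for g
      by (simp add: h_def divide_ennreal[symmetric])
    then have "(\<integral>\<^sup>+g. h g \<partial>std_gauss) = (ennreal (exp ((- z)\<^sup>2 / 2)) + ennreal (exp (z\<^sup>2 / 2))) / 2"
      by (simp only: nn_integral_std_gauss_exp[symmetric])
        (subst nn_integral_divide, measurable, subst nn_integral_add, auto)
    then show ?thesis
      using divide_ennreal[of "2 * exp (z\<^sup>2 / 2)" 2]
      by (simp add: ennreal_plus[symmetric] del: ennreal_plus)
  qed
  also have "ennreal (exp (z\<^sup>2 / 2)) ^ m = ennreal (exp (t\<^sup>2 / 2))"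
    using m by (simp add: ennreal_power exp_of_nat_mult[symmetric] z_def power_divide)
  finally show ?thesis .
qed

text \<open>Markov's inequality at the optimal parameter t = s b; the sign b serves both
  tails.\<close>

lemma prob_net_ge:
  assumes x: "dotp d x x = 1" and m: "m \<ge> 1" and b: "b = 1 \<or> b = -1" and s: "s \<ge> 0"
  shows "measure (init_measure d m) {p \<in> space (init_measure d m). s \<le> b * net d m (snd p) (fst p) x}
    \<le> exp (- s\<^sup>2 / 2)"
proof -
  let ?P = "init_measure d m"
  interpret P: prob_space ?P by (rule prob_space_init_measure)
  note [measurable] = measurable_init_net[of d m x]
  let ?f = "\<lambda>p. ennreal (exp (- s\<^sup>2)) * ennreal (exp (s * b * net d m (snd p) (fst p) x))"
  have "emeasure ?P {p \<in> space ?P. 1 \<le> ?f p}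
      \<le> ennreal (exp (- s\<^sup>2)) * (\<integral>\<^sup>+p. ennreal (exp (s * b * net d m (snd p) (fst p) x)) * indicator (space ?P) p \<partial>?P)"
    by (rule nn_integral_Markov_inequality) auto
  also have "(\<integral>\<^sup>+p. ennreal (exp (s * b * net d m (snd p) (fst p) x)) * indicator (space ?P) p \<partial>?P)
      = (\<integral>\<^sup>+p. ennreal (exp (s * b * net d m (snd p) (fst p) x)) \<partial>?P)"
    by (intro nn_integral_cong) simp
  also have "ennreal (exp (- s\<^sup>2)) * \<dots> \<le> ennreal (exp (- s\<^sup>2)) * ennreal (exp ((s * b)\<^sup>2 / 2))"
    by (intro mult_left_mono nn_integral_exp_net x m) auto
  also have "\<dots> = ennreal (exp (- s\<^sup>2) * exp ((s * b)\<^sup>2 / 2))"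
    by (rule ennreal_mult'[symmetric]) simp
  also have "exp (- s\<^sup>2) * exp ((s * b)\<^sup>2 / 2) = exp (- s\<^sup>2 / 2)"
    using b by (auto simp: exp_add[symmetric] power_mult_distrib)
  finally have "measure ?P {p \<in> space ?P. 1 \<le> ?f p} \<le> exp (- s\<^sup>2 / 2)"
    by (simp add: P.emeasure_eq_measure)
  moreover have "measure ?P {p \<in> space ?P. s \<le> b * net d m (snd p) (fst p) x} \<le> measure ?P {p \<in> space ?P. 1 \<le> ?f p}"
  proof (rule P.finite_measure_mono)
    have "1 \<le> ?f p" if "s \<le> b * net d m (snd p) (fst p) x" for p
    proof -
      have "s\<^sup>2 \<le> s * b * net d m (snd p) (fst p) x"
        using mult_left_mono[OF that s] by (simp add: power2_eq_square mult.assoc)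
      then have "1 \<le> exp (- s\<^sup>2) * exp (s * b * net d m (snd p) (fst p) x)"
        by (simp add: exp_add[symmetric])
      then show ?thesis by (simp add: ennreal_mult'[symmetric] ennreal_1[symmetric] del: ennreal_1)
    qed
    then show "{p \<in> space ?P. s \<le> b * net d m (snd p) (fst p) x} \<subseteq> {p \<in> space ?P. 1 \<le> ?f p}" by auto
  qed measurable
  ultimately show ?thesis by linarith
qed

text \<open>\<open>rademacher\<close> lives on all reals, so sign vectors with other entries belong
  to the space and have to be removed as a null set.\<close>

lemma prob_not_sign:
  assumes r: "r < m"
  shows "measure (init_measure d m) {p \<in> space (init_measure d m). snd p r \<notin> {1, -1}} = 0"
proof -
  interpret S: prob_space "signs m" by (rule prob_space_signs)
  have "AE b in rademacher. b \<in> {1, -1}"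
    unfolding rademacher_def by (subst AE_measure_pmf_iff) auto
  then have "AE a in signs m. a r \<in> {1, -1}"
    using r by (intro AE_PiM_component prob_space_rademacher) auto
  moreover have [measurable]: "(\<lambda>a. a r) \<in> borel_measurable (signs m)" by (rule measurable_sign[OF r])
  ultimately have "emeasure (signs m) {a \<in> space (signs m). a r \<notin> {1, -1}} = 0"
    by (subst (asm) AE_iff_measurable[OF _ refl]) auto
  moreover have "{p \<in> space (init_measure d m). snd p r \<notin> {1, -1}}
      = space (gauss_weights d m) \<times> {a \<in> space (signs m). a r \<notin> {1, -1}}"
    by (auto simp: init_measure_def space_pair_measure)
  ultimately show ?thesis
    unfolding init_measure_def by (simp add: measure_def S.emeasure_pair_measure_Times)
qed

section \<open>The good event\<close>

lemma root4_power4: "a \<ge> 0 \<Longrightarrow> root 4 a ^ 4 = a"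
  by (rule real_root_pow_pos2) auto

text \<open>Union bound over the data points. The factor 6 makes each of the two output tails at
  most the cube of \<open>\<delta> / n\<close>, and the count of 4 m R makes the unstable neurons
  cost at most its square.\<close>

lemma good_initialization:
  fixes \<delta> :: real
  assumes n: "n \<ge> 1" and m: "m \<ge> 1" and x: "\<And>i. i < n \<Longrightarrow> dotp d (x i) (x i) = 1"
    and \<delta>: "0 < \<delta>" "\<delta> / real n \<le> 1 / 2"
  defines "L \<equiv> ln (real n / \<delta>)"
  assumes L: "L \<le> real m"
  defines "R \<equiv> root 4 (L / real m)"
  obtains G where "G \<in> sets (init_measure d m)" "measure (init_measure d m) G \<ge> 1 - \<delta>"
    "\<And>p i. p \<in> G \<Longrightarrow> i < n \<Longrightarrow> \<bar>net d m (snd p) (fst p) (x i)\<bar> \<le> sqrt (6 * L)"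
    "\<And>p i. p \<in> G \<Longrightarrow> i < n \<Longrightarrow>
       real (card {r. r < m \<and> \<bar>dotp d (fst p r) (x i)\<bar> \<le> R}) \<le> 4 * real m * R"
    "\<And>p r. p \<in> G \<Longrightarrow> r < m \<Longrightarrow> snd p r = 1 \<or> snd p r = -1"
proof -
  let ?P = "init_measure d m"
  interpret P: prob_space ?P by (rule prob_space_init_measure)
  define s where "s = sqrt (6 * L)"
  have n\<delta>: "real n / \<delta> \<ge> 2" using \<delta> n by (simp add: field_simps)
  then have L0: "L > 0" by (simp add: L_def)
  have expL: "exp (- L) = \<delta> / real n"
    using n \<delta> by (simp add: L_def exp_minus)
  have s: "s \<ge> 0" "s\<^sup>2 = 6 * L" using L0 by (auto simp: s_def)
  have R: "R \<ge> 0" using L0 by (simp add: R_def)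
  \<comment> \<open>As L / m is at most 1, its fourth root is no smaller, so the Chernoff exponent
    -2 m R is at most -2 L.\<close>
  have mR: "L \<le> real m * R"
  proof -
    have q: "0 \<le> L / real m" "L / real m \<le> 1" using L0 L m by auto
    have "R \<le> 1" using q unfolding R_def by simp
    then have "R ^ 4 \<le> R ^ 1" using R by (intro power_decreasing) auto
    then have "L / real m \<le> R" using root4_power4[OF q(1)] by (simp add: R_def)
    then show ?thesis using m by (simp add: field_simps)
  qed
  define A where "A b i = {p \<in> space ?P. s \<le> b * net d m (snd p) (fst p) (x i)}" for b i
  define B where "B i = {p \<in> space ?P. 4 * real m * R \<le> real (card {r. r < m \<and> dotp d (fst p r) (x i) \<in> {-R..R}})}" for i
  define Z where "Z r = {p \<in> space ?P. snd p r \<notin> {1, -1}}" for r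
  have A_sets: "A b i \<in> sets ?P" for b i
    unfolding A_def using measurable_init_net[of d m "x i"] by measurable
  have B_sets: "B i \<in> sets ?P" for i
    unfolding B_def using measurable_card_init[of "{-R..R}" m d "x i"] by measurable
  have Z_sets: "Z r \<in> sets ?P" if "r < m" for r
    unfolding Z_def using measurable_init_sign[OF that, of d] by measurable
  define Bad where "Bad = (\<Union>i<n. A 1 i \<union> A (-1) i \<union> B i) \<union> (\<Union>r<m. Z r)"
  have Bad_sets: "Bad \<in> sets ?P" unfolding Bad_def using A_sets B_sets Z_sets by auto
  have A_le: "P.prob (A b i) \<le> (\<delta> / real n) ^ 3" if "i < n" "b = 1 \<or> b = -1" for b i
  proof -
    have "P.prob (A b i) \<le> exp (- s\<^sup>2 / 2)"
      unfolding A_def by (rule prob_net_ge[OF x[OF that(1)] m that(2) s(1)])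
    also have "- s\<^sup>2 / 2 = real 3 * (- L)" by (simp add: s)
    also have "exp (real 3 * (- L)) = (\<delta> / real n) ^ 3" by (simp only: exp_of_nat_mult expL)
    finally show ?thesis .
  qed
  have B_le: "P.prob (B i) \<le> (\<delta> / real n) ^ 2" if "i < n" for i
  proof -
    have "P.prob (B i) \<le> exp (real m * R * (1 + 1\<^sup>2) - 1 * (4 * real m * R))"
      unfolding B_def by (rule prob_card_ge[OF x[OF that] _ std_gauss_Icc_le[OF R] R]) auto
    also have "real m * R * (1 + 1\<^sup>2) - 1 * (4 * real m * R) = - 2 * (real m * R)" by simp
    also have "exp (- 2 * (real m * R)) \<le> exp (real 2 * (- L))" using mR by simp
    also have "\<dots> = (\<delta> / real n) ^ 2" by (simp only: exp_of_nat_mult expL)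
    finally show ?thesis .
  qed
  have "P.prob Bad \<le> P.prob (\<Union>i<n. A 1 i \<union> A (-1) i \<union> B i) + P.prob (\<Union>r<m. Z r)"
    unfolding Bad_def using A_sets B_sets Z_sets by (intro measure_Un_le) auto
  also have "\<dots> \<le> (\<Sum>i<n. P.prob (A 1 i \<union> A (-1) i \<union> B i)) + (\<Sum>r<m. P.prob (Z r))"
    using A_sets B_sets Z_sets by (intro add_mono P.finite_measure_subadditive_finite) auto
  also have "(\<Sum>r<m. P.prob (Z r)) = 0"
    using prob_not_sign by (simp add: Z_def)
  also have "(\<Sum>i<n. P.prob (A 1 i \<union> A (-1) i \<union> B i)) \<le> (\<Sum>i<n. \<delta> / real n)"
  proof (rule sum_mono)
    fix i assume "i \<in> {..<n}"
    then have i: "i < n" by simp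
    have "P.prob (A 1 i \<union> A (-1) i \<union> B i) \<le> P.prob (A 1 i) + P.prob (A (-1) i) + P.prob (B i)"
      using A_sets B_sets
      by (intro order_trans[OF measure_Un_le] add_mono measure_Un_le) auto
    also have "\<dots> \<le> 2 * (\<delta> / real n) ^ 3 + (\<delta> / real n) ^ 2"
      unfolding mult_2 by (intro add_mono A_le[OF i] B_le[OF i] disjI1[OF refl] disjI2[OF refl])
    also have "\<dots> \<le> \<delta> / real n"
    proof -
      \<comment> \<open>The inequality 2 q^3 + q^2 \<le> q is an equality at q = 1/2, which explains
        the hypothesis on \<open>\<delta> / n\<close>.\<close>
      define q where "q = \<delta> / real n"
      have q: "0 \<le> q" "q \<le> 1 / 2" using \<delta> by (auto simp: q_def)
      have "q ^ 2 \<le> q * (1 / 2)" unfolding power2_eq_square using q by (intro mult_left_mono) auto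
      moreover have "q ^ 3 \<le> q * (1 / 4)"
      proof -
        have "q * (q * q) \<le> q * (1 / 2 * (1 / 2))" using q by (intro mult_left_mono mult_mono) auto
        then show ?thesis by (simp add: power3_eq_cube)
      qed
      ultimately have "2 * q ^ 3 + q ^ 2 \<le> q" by linarith
      then show ?thesis by (simp only: q_def)
    qed
    finally show "P.prob (A 1 i \<union> A (-1) i \<union> B i) \<le> \<delta> / real n" .
  qed
  also have "(\<Sum>i<n. \<delta> / real n) = \<delta>" using n by simp
  finally have Bad_le: "P.prob Bad \<le> \<delta>" by simp
  show ?thesis
  proof (rule that[of "space ?P - Bad"])
    show "space ?P - Bad \<in> sets ?P" using Bad_sets by auto
    show "1 - \<delta> \<le> P.prob (space ?P - Bad)" using Bad_le P.prob_compl[OF Bad_sets] by simp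
  next
    fix p i assume "p \<in> space ?P - Bad" "i < n"
    then have "p \<notin> A 1 i" "p \<notin> A (-1) i" "p \<notin> B i" "p \<in> space ?P" by (auto simp: Bad_def)
    then show "\<bar>net d m (snd p) (fst p) (x i)\<bar> \<le> sqrt (6 * L)"
      and "real (card {r. r < m \<and> \<bar>dotp d (fst p r) (x i)\<bar> \<le> R}) \<le> 4 * real m * R"
      by (auto simp: A_def B_def s_def abs_le_iff minus_le_iff conj_commute)
  next
    fix p r assume "p \<in> space ?P - Bad" "r < m"
    then have "p \<notin> Z r" "p \<in> space ?P" by (auto simp: Bad_def)
    then show "snd p r = 1 \<or> snd p r = -1" by (auto simp: Z_def)
  qed
qed

text \<open>On this event x activates no neuron, so for a single data point H(0) = 0 and the
  hypothesis on \<open>lam\<close> fails. It serves as the good event when 1 -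
  \<open>\<delta>\<close> is tiny.\<close>

lemma prob_all_negative:
  assumes x: "dotp d x x = 1"
  shows "{p \<in> space (init_measure d m). \<forall>r<m. dotp d (fst p r) x < 0} \<in> sets (init_measure d m)"
    and "measure (init_measure d m) {p \<in> space (init_measure d m). \<forall>r<m. dotp d (fst p r) x < 0} = (1 / 2) ^ m"
proof -
  interpret G: prob_space "gauss_weights d m" by (rule prob_space_gauss_weights)
  have "{p \<in> space (init_measure d m). \<forall>r\<in>{..<m}. dotp d (fst p r) x < 0} \<in> sets (init_measure d m)"
  proof (rule sets.sets_Collect_finite_All)
    fix r assume "r \<in> {..<m}"
    then have [measurable]: "(\<lambda>p. dotp d (fst p r) x) \<in> borel_measurable (init_measure d m)"
      by (intro measurable_init_dotp) simp
    show "{p \<in> space (init_measure d m). dotp d (fst p r) x < 0} \<in> sets (init_measure d m)"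
      by measurable
  qed simp
  then show "{p \<in> space (init_measure d m). \<forall>r<m. dotp d (fst p r) x < 0} \<in> sets (init_measure d m)"
    by (simp only: Ball_def lessThan_iff)
  define V where "V = {u \<in> space (gauss_weights d m). \<forall>r\<in>{..<m}. dotp d (u r) x < 0}"
  have V: "V \<in> sets (gauss_weights d m)"
    unfolding V_def
  proof (rule sets.sets_Collect_finite_All)
    fix r assume "r \<in> {..<m}"
    then have [measurable]: "(\<lambda>u. dotp d (u r) x) \<in> borel_measurable (gauss_weights d m)"
      by (intro measurable_dotp_weights) simp
    show "{u \<in> space (gauss_weights d m). dotp d (u r) x < 0} \<in> sets (gauss_weights d m)"
      by measurable
  qed simp
  have "emeasure (gauss_weights d m) V = (\<integral>\<^sup>+u. indicator V u \<partial>gauss_weights d m)"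
    using V by simp
  also have "\<dots> = (\<integral>\<^sup>+u. (\<Prod>r<m. indicator {..<0} (dotp d (u r) x)) \<partial>gauss_weights d m)"
    by (intro nn_integral_cong) (auto simp: V_def indicator_def prod_eq_1_iff)
  also have "\<dots> = (\<integral>\<^sup>+g. indicator {..<0} g \<partial>std_gauss) ^ m"
    by (rule nn_integral_gauss_weights_prod[OF x]) auto
  also have "\<dots> = ennreal (1 / 2) ^ m" by (simp add: std_gauss_negative del: ennreal_half)
  also have "\<dots> = ennreal ((1 / 2) ^ m)" by (rule ennreal_power) simp
  finally have "measure (gauss_weights d m) V = (1 / 2) ^ m" by (simp add: measure_def)
  moreover have "{p \<in> space (init_measure d m). \<forall>r<m. dotp d (fst p r) x < 0} = {p \<in> space (init_measure d m). fst p \<in> V}"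
    by (auto simp: V_def init_measure_def space_pair_measure)
  ultimately show "measure (init_measure d m) {p \<in> space (init_measure d m). \<forall>r<m. dotp d (fst p r) x < 0} = (1 / 2) ^ m"
    using prob_init_fst[OF V] by simp
qed

section \<open>Convergence with high probability\<close>

lemma H0_carrier: "H0 n d m x u \<in> carrier_mat n n"
  by (simp add: H0_def)

lemma H0_index:
  assumes "i < n" "j < n"
  shows "H0 n d m x u $$ (i, j) = (1 / real m) * (\<Sum>r<m. dotp d (x i) (x j) *
      (if dotp d (u r) (x i) \<ge> 0 \<and> dotp d (u r) (x j) \<ge> 0 then 1 else 0))"
  using assms by (simp add: H0_def)

lemma H0_sym:
  assumes "i < n" "j < n"
  shows "H0 n d m x u $$ (i, j) = H0 n d m x u $$ (j, i)"
  using assms by (simp add: H0_index dotp_commute[of d "x i"] conj_commute)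

lemma lambda_min_1x1:
  assumes A: "A \<in> carrier_mat 1 1"
  shows "lambda_min A = A $$ (0, 0)"
proof -
  obtain \<mu> where "eigenvalue A \<mu>"
    using symmetric_min_eigenvalue[OF A] by auto
  then have "lambda_min A \<in> {k. eigenvalue A k}"
    unfolding lambda_min_def using finite_eigenvalues[OF A] by (intro Min_in) auto
  then obtain v where v: "v \<in> carrier_vec 1" "v \<noteq> 0\<^sub>v 1" "A *\<^sub>v v = lambda_min A \<cdot>\<^sub>v v"
    using A by (auto simp: eigenvalue_def eigenvector_def)
  have v0: "v $ 0 \<noteq> 0"
    using v(1,2) by (auto simp: vec_eq_iff)
  have "(A *\<^sub>v v) $ 0 = A $$ (0, 0) * v $ 0"
    using A v(1) by (auto simp: scalar_prod_def)
  moreover have "(A *\<^sub>v v) $ 0 = lambda_min A * v $ 0"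
    unfolding v(3) using v(1) by simp
  ultimately show ?thesis using v0 by simp
qed

text \<open>With R = (L / m)^(1/4), the hypothesis on m says c n R \<le> lam. The summand 48 of
  \<open>c\<close> then yields \<open>q_small\<close> for q = 4 m R, and the other one absorbs the
  initial loss into the movement budget of \<open>convergence\<close>. \<open>L\<close> is not tied
  to a confidence level, so that it can also be taken as ln 4.\<close>

lemma fedavg_converges_of_good:
  fixes B L \<eta>l \<eta>g :: real and x :: "nat \<Rightarrow> nat \<Rightarrow> real"
  defines "c \<equiv> 48 + 9 * sqrt (12 + 4 * B\<^sup>2)"
  assumes n: "n \<ge> 1" and m: "m \<ge> 1" and N: "N \<ge> 1" and K: "K \<ge> 1"
    and x_unit: "\<And>i. i < n \<Longrightarrow> dotp d (x i) (x i) = 1"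
    and y: "\<And>i. i < n \<Longrightarrow> \<bar>y i\<bar> \<le> B"
    and S_disj: "\<And>c c'. c < N \<Longrightarrow> c' < N \<Longrightarrow> c \<noteq> c' \<Longrightarrow> S c \<inter> S c' = {}"
    and S_Un: "(\<Union>c<N. S c) = {..<n}"
    and \<eta>l: "0 < \<eta>l" and \<eta>g: "0 < \<eta>g" "\<eta>g \<le> 1"
    and L: "L \<ge> 1 / 2"
    and net_le: "\<And>i. i < n \<Longrightarrow> \<bar>net d m a u0 (x i)\<bar> \<le> sqrt (6 * L)"
    and unstable: "\<And>i. i < n \<Longrightarrow>
       real (card {r. r < m \<and> \<bar>dotp d (u0 r) (x i)\<bar> \<le> root 4 (L / real m)}) \<le> 4 * real m * root 4 (L / real m)"
    and a: "\<And>r. r < m \<Longrightarrow> a r = 1 \<or> a r = -1"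
    and lam_def: "lam = lambda_min (H0 n d m x u0)" and lam: "0 < lam" "lam \<le> 1"
    and m_large: "c ^ 4 * (1 / lam ^ 4) * real n ^ 4 * L \<le> real m"
    and \<eta>l_small: "\<eta>l \<le> 1 / 100 * lam / (cond_number (H0 n d m x u0) * real K * real n ^ 2)"
  shows "pred_err n d m a x y (fedavg d m N K a x y S \<eta>l \<eta>g u0 t)
    \<le> (1 - \<eta>g * \<eta>l * lam * real K / (2 * real N)) ^ t * pred_err n d m a x y u0"
proof -
  define R where "R = root 4 (L / real m)"
  define \<kappa> where "\<kappa> = cond_number (H0 n d m x u0)"
  have Lm: "0 \<le> L / real m" using L by simp
  have R0: "R \<ge> 0" using L by (simp add: R_def)
  have R4: "R ^ 4 = L / real m" using root4_power4[OF Lm] by (simp add: R_def)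
  \<comment> \<open>The outputs are of order sqrt L; this expresses them in the unit R^2 sqrt m, one
    factor R of which is paid for by \<open>lam\<close>.\<close>
  have R2: "R\<^sup>2 * sqrt (real m) = sqrt L"
  proof -
    have "(R\<^sup>2 * sqrt (real m))\<^sup>2 = R ^ 4 * real m" by (simp add: power_mult_distrib)
    also have "\<dots> = L" using m by (simp add: R4)
    finally show ?thesis using R0 by (intro real_sqrt_unique[symmetric]) auto
  qed
  have c: "c \<ge> 48" "9 * sqrt (12 + 4 * B\<^sup>2) \<le> c" by (auto simp: c_def)
  have lam_ge: "c * real n * R \<le> lam"
  proof -
    have "c ^ 4 * real n ^ 4 * L \<le> real m * lam ^ 4"
      using m_large lam by (simp add: field_simps)
    then have "(c * real n * R) ^ 4 \<le> lam ^ 4"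
      using m by (simp add: power_mult_distrib R4 field_simps)
    then show ?thesis using power_le_imp_le_base[of "c * real n * R" 3 lam] lam by simp
  qed
  have nR: "48 * real n * R \<le> lam"
    using mult_right_mono[OF c(1), of "real n * R"] R0 lam_ge by (simp add: mult.assoc)
  have "\<kappa> > 0"
  proof (rule ccontr)
    assume "\<not> 0 < \<kappa>"
    then have "1 / 100 * lam / (\<kappa> * real K * real n ^ 2) \<le> 0"
      using lam by (intro divide_nonneg_nonpos mult_nonpos_nonneg) auto
    then show False using \<eta>l_small \<eta>l by (simp add: \<kappa>_def)
  qed
  then have \<kappa>: "\<kappa> \<ge> 1"
    using cond_number_cases[OF H0_carrier n, of d m x u0] by (auto simp: \<kappa>_def)
  have \<eta>l_lam: "\<eta>l * real K * (real n)\<^sup>2 \<le> lam / 100"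
  proof -
    have "\<eta>l * (\<kappa> * real K * real n ^ 2) \<le> lam / 100"
      using \<eta>l_small \<open>\<kappa> > 0\<close> K n by (simp add: \<kappa>_def[symmetric] field_simps)
    moreover have "(\<eta>l * real K * real n ^ 2) * 1 \<le> (\<eta>l * real K * real n ^ 2) * \<kappa>"
      using \<kappa> \<eta>l by (intro mult_left_mono) auto
    ultimately show ?thesis by (simp add: mult_ac)
  qed
  interpret fedavg_stable n d m N K x y S \<eta>l \<eta>g a u0 R "4 * real m * R" lam
  proof
    have "\<eta>l * real K * real n * 1 \<le> \<eta>l * real K * real n * real n"
      using n \<eta>l by (intro mult_left_mono) auto
    then show "\<eta>l * real K * real n \<le> 1 / 100"
      using \<eta>l_lam lam by (simp add: power2_eq_square mult.assoc)
    show "12 * real n * (4 * real m * R) \<le> lam * real m"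
      using mult_right_mono[OF nR, of "real m"] by (simp add: mult_ac)
    show "real (card {r. r < m \<and> \<bar>dotp d (u0 r) (x i)\<bar> \<le> R}) \<le> 4 * real m * R" if "i < n" for i
      unfolding R_def by (rule unstable[OF that])
    fix v :: "nat \<Rightarrow> real"
    have "lam * (\<Sum>i<n. (v i)\<^sup>2) \<le> bilin n (\<lambda>i j. H0 n d m x u0 $$ (i, j)) v v"
      unfolding lam_def by (rule lambda_min_le_bilin[OF H0_carrier n H0_sym])
    also have "\<dots> =
      (\<Sum>i<n. v i * (\<Sum>j<n. (1 / real m) * (\<Sum>r<m. dotp d (x i) (x j) *
         (if dotp d (u0 r) (x i) \<ge> 0 \<and> dotp d (u0 r) (x j) \<ge> 0 then 1 else 0)) * v j))"
      unfolding bilin_def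
      by (intro sum.cong arg_cong2[where f = "(*)"] refl H0_index) auto
    finally show "lam * (\<Sum>i<n. (v i)\<^sup>2) \<le>
      (\<Sum>i<n. v i * (\<Sum>j<n. (1 / real m) * (\<Sum>r<m. dotp d (x i) (x j) *
         (if dotp d (u0 r) (x i) \<ge> 0 \<and> dotp d (u0 r) (x j) \<ge> 0 then 1 else 0)) * v j))" .
  qed (use n m N K x_unit S_disj S_Un \<eta>l \<eta>g a lam \<eta>l_lam in auto)
  define P0 where "P0 = pred_err n d m a x y u0"
  have P0_le: "P0 \<le> real n * (L * (12 + 4 * B\<^sup>2))"
  proof -
    have "(net d m a u0 (x i) - y i)\<^sup>2 \<le> L * (12 + 4 * B\<^sup>2)" if i: "i < n" for i
    proof -
      have "\<bar>net d m a u0 (x i)\<bar>\<^sup>2 \<le> (sqrt (6 * L))\<^sup>2"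
        using net_le[OF i] by (intro power_mono) auto
      then have 1: "(net d m a u0 (x i))\<^sup>2 \<le> 6 * L" using L by simp
      have "\<bar>y i\<bar>\<^sup>2 \<le> B\<^sup>2" using y[OF i] by (intro power_mono) auto
      then have 2: "(y i)\<^sup>2 \<le> B\<^sup>2" by simp
      \<comment> \<open>Because L is at least 1/2, the labels too are bounded by a multiple of
        L.\<close>
      have 3: "2 * B\<^sup>2 \<le> 4 * (L * B\<^sup>2)" using mult_right_mono[OF L, of "B\<^sup>2"] by simp
      have "(net d m a u0 (x i) - y i)\<^sup>2 \<le> 2 * (net d m a u0 (x i))\<^sup>2 + 2 * (y i)\<^sup>2"
        using zero_le_power2[of "net d m a u0 (x i) + y i"] by (simp add: power2_eq_square algebra_simps)
      then show ?thesis using 1 2 3 by (simp add: algebra_simps)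
    qed
    then have "P0 \<le> (\<Sum>i<n. L * (12 + 4 * B\<^sup>2))"
      unfolding P0_def pred_err_def by (intro sum_mono) auto
    then show ?thesis by simp
  qed
  have "9 * sqrt (real n) * sqrt P0 \<le> 9 * sqrt (real n) * sqrt (real n * (L * (12 + 4 * B\<^sup>2)))"
    using P0_le by (intro mult_left_mono real_sqrt_le_mono) auto
  also have "\<dots> = (9 * sqrt (12 + 4 * B\<^sup>2)) * (real n * sqrt L)"
    by (simp add: real_sqrt_mult)
  also have "\<dots> \<le> c * (real n * sqrt L)"
    using c L by (intro mult_right_mono) auto
  also have "\<dots> = (c * real n * R) * (R * sqrt (real m))"
    unfolding R2[symmetric] by (simp add: power2_eq_square mult_ac)
  also have "\<dots> \<le> lam * (R * sqrt (real m))"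
    using lam_ge R0 by (intro mult_right_mono) auto
  finally have "9 * sqrt (real n) * sqrt P0 \<le> R * lam * sqrt (real m)" by (simp add: mult_ac)
  from convergence[OF this[unfolded P0_def], of t]
  show ?thesis by (simp add: \<alpha>_def mult_ac)
qed

text \<open>A consequence of the width hypothesis that is free of the random \<open>lam\<close>,
  used to recognise when that hypothesis fails on the whole space.\<close>

lemma overparametrization_ge:
  fixes C L lam :: real
  assumes "C \<ge> 0" "L \<ge> 0" "0 < lam" "lam \<le> 1" "n \<ge> 1"
    and "C * (1 / lam ^ 4) * real n ^ 4 * L \<le> real m"
  shows "C * L \<le> real m"
proof -
  have "1 \<le> 1 / lam ^ 4" using assms by (simp add: power_le_one)
  moreover have "1 \<le> real n ^ 4" using assms by simp
  ultimately have "1 * 1 \<le> (1 / lam ^ 4) * real n ^ 4" by (intro mult_mono) auto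
  then have "(C * L) * 1 \<le> (C * L) * ((1 / lam ^ 4) * real n ^ 4)"
    using assms by (intro mult_left_mono) auto
  then show ?thesis using assms(6) by (simp add: mult_ac)
qed

text \<open>The event of \<open>good_initialization\<close> at confidence 3/4 is intersected with
  the event that at most 3/4 of the neurons are inactive. For one unit data point,
  \<open>lam\<close> is the fraction of active neurons.\<close>

lemma one_sample_good_initialization:
  assumes m: "m \<ge> 100" and x: "dotp d (x 0) (x 0) = 1"
  obtains G where "G \<in> sets (init_measure d m)" "measure (init_measure d m) G \<ge> 1 / 2"
    "\<And>p. p \<in> G \<Longrightarrow> \<bar>net d m (snd p) (fst p) (x 0)\<bar> \<le> sqrt (6 * ln 4)"
    "\<And>p. p \<in> G \<Longrightarrow>
       real (card {r. r < m \<and> \<bar>dotp d (fst p r) (x 0)\<bar> \<le> root 4 (ln 4 / real m)}) \<le> 4 * real m * root 4 (ln 4 / real m)"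
    "\<And>p r. p \<in> G \<Longrightarrow> r < m \<Longrightarrow> snd p r = 1 \<or> snd p r = -1"
    "\<And>p. p \<in> G \<Longrightarrow> 1 / 4 \<le> lambda_min (H0 1 d m x (fst p))"
proof -
  let ?P = "init_measure d m"
  interpret P: prob_space ?P by (rule prob_space_init_measure)
  have ln4: "ln (4 :: real) \<le> real m"
    using ln_le_minus_one[of "4 :: real"] m by simp
  obtain G where G: "G \<in> sets ?P" "P.prob G \<ge> 3 / 4"
    "\<And>p. p \<in> G \<Longrightarrow> \<bar>net d m (snd p) (fst p) (x 0)\<bar> \<le> sqrt (6 * ln 4)"
    "\<And>p. p \<in> G \<Longrightarrow>
       real (card {r. r < m \<and> \<bar>dotp d (fst p r) (x 0)\<bar> \<le> root 4 (ln 4 / real m)}) \<le> 4 * real m * root 4 (ln 4 / real m)"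
    "\<And>p r. p \<in> G \<Longrightarrow> r < m \<Longrightarrow> snd p r = 1 \<or> snd p r = -1"
    by (rule good_initialization[of 1 m d x "1 / 4"]) (use m x ln4 in auto)
  define T where "T = {p \<in> space ?P. 3 / 4 * real m \<le> real (card {r. r < m \<and> dotp d (fst p r) (x 0) \<in> {..<0}})}"
  have T: "T \<in> sets ?P"
    unfolding T_def using measurable_card_init[of "{..<0}" m d "x 0"] by measurable
  \<comment> \<open>Chernoff with p = 1/2 and \<open>\<theta>\<close> = 1/4 gives the exponent -m /
    32; m \<ge> 100 makes exp (m / 32) at least 4.\<close>
  have "P.prob T \<le> exp (real m * (1 / 2) * (1 / 4 + (1 / 4)\<^sup>2) - 1 / 4 * (3 / 4 * real m))"
    unfolding T_def by (rule prob_card_ge[OF x]) (auto simp: std_gauss_negative simp del: ennreal_half)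
  also have "\<dots> = inverse (exp (real m / 32))"
    unfolding exp_minus[symmetric] by (simp add: power2_eq_square)
  also have "\<dots> \<le> inverse 4"
  proof (rule le_imp_inverse_le)
    show "4 \<le> exp (real m / 32)"
      using exp_ge_add_one_self[of "real m / 32"] m by linarith
  qed simp
  finally have PT: "P.prob T \<le> 1 / 4" by simp
  have "P.prob G \<le> P.prob ((G - T) \<union> T)"
    using G T by (intro P.finite_measure_mono) auto
  also have "\<dots> \<le> P.prob (G - T) + P.prob T"
    using G T by (intro measure_Un_le) auto
  finally have PG: "1 / 2 \<le> P.prob (G - T)" using G(2) PT by linarith
  have lam: "1 / 4 \<le> lambda_min (H0 1 d m x (fst p))" if p: "p \<in> G - T" for p
  proof -
    have psp: "p \<in> space ?P" using p G(1) sets.sets_into_space by blast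
    define I where "I = {r. r < m \<and> dotp d (fst p r) (x 0) < 0}"
    have fin: "finite I" "I \<subseteq> {..<m}" by (auto simp: I_def)
    have I: "real (card I) \<le> 3 / 4 * real m" using p psp by (auto simp: T_def I_def)
    have "(\<Sum>r<m. dotp d (x 0) (x 0) * (if dotp d (fst p r) (x 0) \<ge> 0 \<and> dotp d (fst p r) (x 0) \<ge> 0 then 1 else 0))
        = (\<Sum>r\<in>{..<m}. if r \<in> I then 0 else 1 :: real)"
      using x by (intro sum.cong) (auto simp: I_def)
    also have "\<dots> = real (card ({..<m} - I))"
      by (simp add: sum.If_cases Diff_eq)
    also have "\<dots> = real m - real (card I)"
      using fin card_mono[OF _ fin(2)] by (simp add: card_Diff_subset of_nat_diff)
    finally have "H0 1 d m x (fst p) $$ (0, 0) = (real m - real (card I)) / real m"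
      by (simp add: H0_index)
    moreover have "1 / 4 \<le> (real m - real (card I)) / real m"
      using I m by (simp add: field_simps)
    ultimately show ?thesis by (simp only: lambda_min_1x1[OF H0_carrier])
  qed
  show ?thesis
    by (rule that[of "G - T"]) (use G T PG lam in auto)
qed

text \<open>\<open>lam\<close> and \<open>kap\<close> are functions of the random weights, so the
  hypotheses on them stand inside the event \<open>E\<close>, which is chosen before they are
  known.\<close>

theorem theoremB3:
  fixes B :: real
  assumes "B > 0"
  shows "\<exists>C c_loc c_glob. C > 0 \<and> c_loc > 0 \<and> c_glob > 0 \<and>
    (\<forall>(n::nat) (d::nat) (m::nat) (N::nat) (K::nat) (x :: nat \<Rightarrow> nat \<Rightarrow> real) (y :: nat \<Rightarrow> real)
       (S :: nat \<Rightarrow> nat set) (\<delta>::real) (eta_l::real) (eta_g::real).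
      n \<ge> 1 \<and> d \<ge> 1 \<and> m \<ge> 1 \<and> N \<ge> 1 \<and> K \<ge> 1 \<and>
      (\<forall>i<n. dotp d (x i) (x i) = 1) \<and>
      (\<forall>i<n. \<bar>y i\<bar> \<le> B) \<and>
      (\<forall>c<N. S c \<noteq> {}) \<and>
      (\<forall>c<N. \<forall>c'<N. c \<noteq> c' \<longrightarrow> S c \<inter> S c' = {}) \<and>
      (\<Union>c<N. S c) = {..<n} \<and>
      0 < \<delta> \<and> \<delta> < 1 \<and>
      0 < eta_l \<and> 0 < eta_g \<and> eta_g \<le> c_glob
      \<longrightarrow>
      (\<exists>E \<in> sets (init_measure d m). measure (init_measure d m) E \<ge> 1 - \<delta> \<and>
        (\<forall>(u0, a) \<in> E.
          (let H = H0 n d m x u0; lam = lambda_min H; kap = cond_number H in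
           0 < lam \<and> lam \<le> 1 \<and>
           real m \<ge> C * (1 / lam ^ 4) * real n ^ 4 * ln (real n / \<delta>) \<and>
           eta_l \<le> c_loc * lam / (kap * real K * real n ^ 2)
           \<longrightarrow>
           (\<forall>t. pred_err n d m a x y (fedavg d m N K a x y S eta_l eta_g u0 t)
                 \<le> (1 - eta_g * eta_l * lam * real K / (2 * real N)) ^ t
                   * pred_err n d m a x y u0)))))"
proof -
  \<comment> \<open>\<open>C1\<close> is the width constant of
    \<open>fedavg_converges_of_good\<close>. \<open>M\<close> is the width from which the one-sample
    argument works: 512 = 256 * 2 covers \<open>lam\<close> \<ge> 1/4 and ln 4 \<le> 2. The summand
    M 2^M of \<open>C\<close> rules out widths below \<open>M\<close> once 1 -
    \<open>\<delta>\<close> exceeds 2^-m.\<close>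
  define C1 where "C1 = (48 + 9 * sqrt (12 + 4 * B\<^sup>2)) ^ 4"
  define M where "M = 100 + nat \<lceil>512 * C1\<rceil>"
  define C where "C = C1 + real M * 2 ^ M"
  have C1: "C1 \<ge> 1"
  proof -
    have "1 \<le> 48 + 9 * sqrt (12 + 4 * B\<^sup>2)"
      using real_sqrt_ge_zero[of "12 + 4 * B\<^sup>2"] by simp
    then show ?thesis unfolding C1_def by (rule one_le_power)
  qed
  have M: "M \<ge> 100" "512 * C1 \<le> real M" using C1 by (auto simp: M_def) linarith
  have "C1 \<le> C" by (simp add: C_def)
  moreover have "real M * 2 ^ M \<le> C" using C1 by (simp add: C_def)
  ultimately have C: "C \<ge> C1" "real M * 2 ^ M \<le> C" "C \<ge> 1" using C1 by linarith+
  have main: "\<exists>E \<in> sets (init_measure d m). measure (init_measure d m) E \<ge> 1 - \<delta> \<and>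
      (\<forall>p\<in>E. 0 < lambda_min (H0 n d m x (fst p)) \<longrightarrow> lambda_min (H0 n d m x (fst p)) \<le> 1 \<longrightarrow>
        C * (1 / lambda_min (H0 n d m x (fst p)) ^ 4) * real n ^ 4 * ln (real n / \<delta>) \<le> real m \<longrightarrow>
        \<eta>l \<le> 1 / 100 * lambda_min (H0 n d m x (fst p)) / (cond_number (H0 n d m x (fst p)) * real K * real n ^ 2) \<longrightarrow>
        (\<forall>t. pred_err n d m (snd p) x y (fedavg d m N K (snd p) x y S \<eta>l \<eta>g (fst p) t)
          \<le> (1 - \<eta>g * \<eta>l * lambda_min (H0 n d m x (fst p)) * real K / (2 * real N)) ^ t
            * pred_err n d m (snd p) x y (fst p)))"
    (is "\<exists>E \<in> sets ?P. _ E \<and> (\<forall>p\<in>E. ?good p)")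
    if n: "n \<ge> 1" and m: "m \<ge> 1" and N: "N \<ge> 1" and K: "K \<ge> 1"
      and x: "\<And>i. i < n \<Longrightarrow> dotp d (x i) (x i) = 1" and y: "\<And>i. i < n \<Longrightarrow> \<bar>y i\<bar> \<le> B"
      and S: "\<And>c c'. c < N \<Longrightarrow> c' < N \<Longrightarrow> c \<noteq> c' \<Longrightarrow> S c \<inter> S c' = {}" "(\<Union>c<N. S c) = {..<n}"
      and \<delta>: "0 < \<delta>" "\<delta> < 1" and \<eta>: "0 < \<eta>l" "0 < \<eta>g" "\<eta>g \<le> 1"
    for n d m N K :: nat and x :: "nat \<Rightarrow> nat \<Rightarrow> real" and y S and \<delta> \<eta>l \<eta>g :: real
  proof -
    interpret P: prob_space ?P by (rule prob_space_init_measure)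
    define L where "L = ln (real n / \<delta>)"
    have whole: ?thesis if "\<And>p. ?good p"
      using that P.prob_space \<delta> by (intro bexI[of _ "space ?P"]) auto
    \<comment> \<open>In this range the width hypothesis fails for every admissible
      \<open>lam\<close>, so the whole space is a good event.\<close>
    have vacuous: ?thesis if "real m < C * L" "L \<ge> 0"
    proof (rule whole, intro impI)
      fix p :: "(nat \<Rightarrow> nat \<Rightarrow> real) \<times> (nat \<Rightarrow> real)"
      assume "0 < lambda_min (H0 n d m x (fst p))" "lambda_min (H0 n d m x (fst p)) \<le> 1"
        "C * (1 / lambda_min (H0 n d m x (fst p)) ^ 4) * real n ^ 4 * ln (real n / \<delta>) \<le> real m"
      from overparametrization_ge[OF _ _ this(1,2) n this(3)[folded L_def]] that C
      have False by simp
      then show "\<forall>t. pred_err n d m (snd p) x y (fedavg d m N K (snd p) x y S \<eta>l \<eta>g (fst p) t)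
          \<le> (1 - \<eta>g * \<eta>l * lambda_min (H0 n d m x (fst p)) * real K / (2 * real N)) ^ t
            * pred_err n d m (snd p) x y (fst p)" ..
    qed
    have conv: "pred_err n d m a x y (fedavg d m N K a x y S \<eta>l \<eta>g u0 t)
        \<le> (1 - \<eta>g * \<eta>l * lambda_min (H0 n d m x u0) * real K / (2 * real N)) ^ t * pred_err n d m a x y u0"
      if "1 / 2 \<le> L'" "\<And>i. i < n \<Longrightarrow> \<bar>net d m a u0 (x i)\<bar> \<le> sqrt (6 * L')"
        "\<And>i. i < n \<Longrightarrow>
          real (card {r. r < m \<and> \<bar>dotp d (u0 r) (x i)\<bar> \<le> root 4 (L' / real m)}) \<le> 4 * real m * root 4 (L' / real m)"
        "\<And>r. r < m \<Longrightarrow> a r = 1 \<or> a r = -1"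
        "0 < lambda_min (H0 n d m x u0)" "lambda_min (H0 n d m x u0) \<le> 1"
        "C1 * (1 / lambda_min (H0 n d m x u0) ^ 4) * real n ^ 4 * L' \<le> real m"
        "\<eta>l \<le> 1 / 100 * lambda_min (H0 n d m x u0) / (cond_number (H0 n d m x u0) * real K * real n ^ 2)"
      for a u0 L' t
      by (rule fedavg_converges_of_good[where B = B and L = L', folded C1_def])
        (fact n m N K x y S \<eta> that | rule refl)+
    have half_ln2: "1 / 2 \<le> ln (2 :: real)"
    proof -
      have "exp (1 / 2) \<le> (2 :: real)" using exp_bound[of "1 / 2 :: real"] by (simp add: power2_eq_square)
      then show ?thesis by (subst ln_ge_iff) auto
    qed
    show ?thesis
    proof (cases "\<delta> / real n \<le> 1 / 2")
      case True
      have "2 \<le> real n / \<delta>" using True \<delta> n by (simp add: field_simps)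
      then have "ln 2 \<le> L" unfolding L_def by (intro ln_mono) auto
      with half_ln2 have L: "L \<ge> 1 / 2" by linarith
      show ?thesis
      proof (cases "L \<le> real m")
        case False
        have "1 * L \<le> C * L" using C L by (intro mult_right_mono) auto
        with False have "real m < C * L" by linarith
        then show ?thesis using L by (intro vacuous) auto
      next
        case Lm: True
        obtain G where G: "G \<in> sets ?P" "P.prob G \<ge> 1 - \<delta>"
          "\<And>p i. p \<in> G \<Longrightarrow> i < n \<Longrightarrow> \<bar>net d m (snd p) (fst p) (x i)\<bar> \<le> sqrt (6 * L)"
          "\<And>p i. p \<in> G \<Longrightarrow> i < n \<Longrightarrow>
             real (card {r. r < m \<and> \<bar>dotp d (fst p r) (x i)\<bar> \<le> root 4 (L / real m)}) \<le> 4 * real m * root 4 (L / real m)"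
          "\<And>p r. p \<in> G \<Longrightarrow> r < m \<Longrightarrow> snd p r = 1 \<or> snd p r = -1"
          by (rule good_initialization[where x = x, OF n m x \<delta>(1) True Lm[unfolded L_def], folded L_def]) (assumption, rule that)
        show ?thesis
        proof (intro bexI[of _ G] conjI ballI impI allI G(1,2))
          fix p :: "(nat \<Rightarrow> nat \<Rightarrow> real) \<times> (nat \<Rightarrow> real)" and t :: nat
          let ?lam = "lambda_min (H0 n d m x (fst p))"
          assume p: "p \<in> G" and lam: "0 < ?lam" "?lam \<le> 1"
            and mC: "C * (1 / ?lam ^ 4) * real n ^ 4 * ln (real n / \<delta>) \<le> real m"
            and \<eta>l: "\<eta>l \<le> 1 / 100 * ?lam / (cond_number (H0 n d m x (fst p)) * real K * real n ^ 2)"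
          have "C1 * (1 / ?lam ^ 4) * real n ^ 4 * L \<le> C * (1 / ?lam ^ 4) * real n ^ 4 * L"
            using C lam L by (intro mult_right_mono) auto
          with mC have mC1: "C1 * (1 / ?lam ^ 4) * real n ^ 4 * L \<le> real m" by (simp only: L_def)
          show "pred_err n d m (snd p) x y (fedavg d m N K (snd p) x y S \<eta>l \<eta>g (fst p) t)
            \<le> (1 - \<eta>g * \<eta>l * ?lam * real K / (2 * real N)) ^ t * pred_err n d m (snd p) x y (fst p)"
            by (rule conv) (fact L G(3)[OF p] G(4)[OF p] G(5)[OF p] lam mC1 \<eta>l)+
        qed
      qed
    next
      case False
      then have "real n < 2 * \<delta>" using n by (simp add: field_simps)
      then have n1: "n = 1" using \<delta> n by linarith
      have "L = - ln \<delta>" using \<delta> by (simp add: L_def n1 ln_div)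
      \<comment> \<open>\<open>L\<close> may now be arbitrarily small, but it still dominates the
        probability that the good event must have.\<close>
      then have L: "1 - \<delta> \<le> L" using ln_le_minus_one[of \<delta>] \<delta> by simp
      have \<delta>2: "1 - \<delta> < 1 / 2" using False n1 by simp
      have x0: "dotp d (x 0) (x 0) = 1" using x n1 by simp
      consider "1 - \<delta> \<le> (1 / 2) ^ m" | "(1 / 2) ^ m < 1 - \<delta>" "m < M" | "m \<ge> M" by linarith
      then show ?thesis
      proof cases
        case 1
        let ?E = "{p \<in> space ?P. \<forall>r<m. dotp d (fst p r) (x 0) < 0}"
        have singular: "\<not> 0 < lambda_min (H0 n d m x (fst p))" if "p \<in> ?E" for p
        proof -
          have "(if dotp d (fst p r) (x 0) \<ge> 0 \<and> dotp d (fst p r) (x 0) \<ge> 0 then 1 else 0 :: real) = 0" if "r < m" for r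
            using \<open>p \<in> ?E\<close> that by (auto simp: not_le)
          then have "H0 1 d m x (fst p) $$ (0, 0) = 0" by (simp add: H0_index)
          then have "lambda_min (H0 1 d m x (fst p)) = 0" by (simp only: lambda_min_1x1[OF H0_carrier])
          then show ?thesis unfolding n1 by (simp only: less_irrefl not_False_eq_True)
        qed
        show ?thesis
        proof (rule bexI[of _ ?E], rule conjI)
          show "1 - \<delta> \<le> P.prob ?E" using 1 by (simp only: prob_all_negative(2)[OF x0])
          show "\<forall>p\<in>?E. ?good p" by (intro ballI impI) (rule notE[OF singular])
        qed (rule prob_all_negative(1)[OF x0])
      next
        case 2
        \<comment> \<open>Here L \<ge> 1 - \<open>\<delta>\<close> > 2^-m \<ge> 2^-M, so C L exceeds
          M and hence m: the width hypothesis fails.\<close>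
        have "real m < real M * 2 ^ M * (1 / 2) ^ M"
          using 2 by (simp add: power_divide)
        also have "\<dots> \<le> C * (1 / 2) ^ m"
          using C 2 by (intro mult_mono power_decreasing) auto
        also have "\<dots> \<le> C * L"
          using C 2 L by (intro mult_left_mono) auto
        finally show ?thesis using L \<delta> by (intro vacuous) auto
      next
        case 3
        obtain G where G: "G \<in> sets ?P" "P.prob G \<ge> 1 / 2"
          "\<And>p. p \<in> G \<Longrightarrow> \<bar>net d m (snd p) (fst p) (x 0)\<bar> \<le> sqrt (6 * ln 4)"
          "\<And>p. p \<in> G \<Longrightarrow>
             real (card {r. r < m \<and> \<bar>dotp d (fst p r) (x 0)\<bar> \<le> root 4 (ln 4 / real m)}) \<le> 4 * real m * root 4 (ln 4 / real m)"
          "\<And>p r. p \<in> G \<Longrightarrow> r < m \<Longrightarrow> snd p r = 1 \<or> snd p r = -1"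
          "\<And>p. p \<in> G \<Longrightarrow> 1 / 4 \<le> lambda_min (H0 1 d m x (fst p))"
          by (rule one_sample_good_initialization[where x = x, OF order_trans[OF M(1) 3] x0]) (rule that)
        have ln4: "1 / 2 \<le> ln (4 :: real)" "ln (4 :: real) \<le> 2"
        proof -
          have "ln (4 :: real) = ln 2 + ln 2" using ln_mult[of 2 "2 :: real"] by simp
          then show "1 / 2 \<le> ln (4 :: real)" "ln (4 :: real) \<le> 2"
            using half_ln2 ln_le_minus_one[of "2 :: real"] by auto
        qed
        show ?thesis
        proof (intro bexI[of _ G] conjI ballI impI allI G(1))
          show "1 - \<delta> \<le> P.prob G" using G(2) \<delta>2 by simp
        next
          fix p :: "(nat \<Rightarrow> nat \<Rightarrow> real) \<times> (nat \<Rightarrow> real)" and t :: nat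
          let ?lam = "lambda_min (H0 n d m x (fst p))"
          assume p: "p \<in> G" and lam: "0 < ?lam" "?lam \<le> 1"
            and \<eta>l: "\<eta>l \<le> 1 / 100 * ?lam / (cond_number (H0 n d m x (fst p)) * real K * real n ^ 2)"
          have lam4: "1 / 4 \<le> ?lam" using G(6)[OF p] n1 by simp
          \<comment> \<open>The given width hypothesis is too weak for small \<open>L\<close>; the
            width needed with ln 4 in its place comes from \<open>lam\<close> \<ge> 1/4 and m \<ge>
            M.\<close>
          have "C1 * (1 / ?lam ^ 4) * real n ^ 4 * ln 4 \<le> C1 * 256 * 1 * 2"
          proof (intro mult_mono)
            have "(1 / 4) ^ 4 \<le> ?lam ^ 4" using lam4 by (intro power_mono) auto
            then have "1 / ?lam ^ 4 \<le> 1 / (1 / 4) ^ 4" using lam by (intro divide_left_mono) auto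
            then show "1 / ?lam ^ 4 \<le> 256" by (simp add: power_divide)
          qed (use C1 ln4 n1 lam in auto)
          also have "\<dots> \<le> real m" using M 3 by simp
          finally have mC: "C1 * (1 / ?lam ^ 4) * real n ^ 4 * ln 4 \<le> real m" .
          have i0: "i = 0" if "i < n" for i using that n1 by simp
          have net_le: "\<bar>net d m (snd p) (fst p) (x i)\<bar> \<le> sqrt (6 * ln 4)" if "i < n" for i
            unfolding i0[OF that] by (rule G(3)[OF p])
          have card_le: "real (card {r. r < m \<and> \<bar>dotp d (fst p r) (x i)\<bar> \<le> root 4 (ln 4 / real m)})
              \<le> 4 * real m * root 4 (ln 4 / real m)" if "i < n" for i
            unfolding i0[OF that] by (rule G(4)[OF p])
          show "pred_err n d m (snd p) x y (fedavg d m N K (snd p) x y S \<eta>l \<eta>g (fst p) t)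
            \<le> (1 - \<eta>g * \<eta>l * ?lam * real K / (2 * real N)) ^ t * pred_err n d m (snd p) x y (fst p)"
            by (rule conv) (fact ln4(1) net_le card_le G(5)[OF p] lam mC \<eta>l)+
        qed
      qed
    qed
  qed
  show ?thesis
  proof (rule exI[of _ C], rule exI[of _ "1 / 100"], rule exI[of _ 1], intro conjI allI impI)
    show "C > 0" using C by simp
  next
    fix n d m N K :: nat and x :: "nat \<Rightarrow> nat \<Rightarrow> real" and y :: "nat \<Rightarrow> real" and S :: "nat \<Rightarrow> nat set"
      and \<delta> eta_l eta_g :: real
    assume H: "n \<ge> 1 \<and> d \<ge> 1 \<and> m \<ge> 1 \<and> N \<ge> 1 \<and> K \<ge> 1 \<and>
      (\<forall>i<n. dotp d (x i) (x i) = 1) \<and>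
      (\<forall>i<n. \<bar>y i\<bar> \<le> B) \<and>
      (\<forall>c<N. S c \<noteq> {}) \<and>
      (\<forall>c<N. \<forall>c'<N. c \<noteq> c' \<longrightarrow> S c \<inter> S c' = {}) \<and>
      (\<Union>c<N. S c) = {..<n} \<and>
      0 < \<delta> \<and> \<delta> < 1 \<and>
      0 < eta_l \<and> 0 < eta_g \<and> eta_g \<le> 1"
    show "\<exists>E \<in> sets (init_measure d m). measure (init_measure d m) E \<ge> 1 - \<delta> \<and>
        (\<forall>(u0, a) \<in> E.
          (let H = H0 n d m x u0; lam = lambda_min H; kap = cond_number H in
           0 < lam \<and> lam \<le> 1 \<and>
           real m \<ge> C * (1 / lam ^ 4) * real n ^ 4 * ln (real n / \<delta>) \<and>
           eta_l \<le> 1 / 100 * lam / (kap * real K * real n ^ 2)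
           \<longrightarrow>
           (\<forall>t. pred_err n d m a x y (fedavg d m N K a x y S eta_l eta_g u0 t)
                 \<le> (1 - eta_g * eta_l * lam * real K / (2 * real N)) ^ t
                   * pred_err n d m a x y u0)))"
    proof -
      from H have "n \<ge> 1" "m \<ge> 1" "N \<ge> 1" "K \<ge> 1" "\<And>i. i < n \<Longrightarrow> dotp d (x i) (x i) = 1"
        "\<And>i. i < n \<Longrightarrow> \<bar>y i\<bar> \<le> B"
        "\<And>c c'. c < N \<Longrightarrow> c' < N \<Longrightarrow> c \<noteq> c' \<Longrightarrow> S c \<inter> S c' = {}"
        "(\<Union>c<N. S c) = {..<n}" "0 < \<delta>" "\<delta> < 1" "0 < eta_l" "0 < eta_g" "eta_g \<le> 1"
        by simp_all
      note facts = this
      have "\<exists>E \<in> sets (init_measure d m). measure (init_measure d m) E \<ge> 1 - \<delta> \<and>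
        (\<forall>p\<in>E. 0 < lambda_min (H0 n d m x (fst p)) \<longrightarrow> lambda_min (H0 n d m x (fst p)) \<le> 1 \<longrightarrow>
          C * (1 / lambda_min (H0 n d m x (fst p)) ^ 4) * real n ^ 4 * ln (real n / \<delta>) \<le> real m \<longrightarrow>
          eta_l \<le> 1 / 100 * lambda_min (H0 n d m x (fst p)) / (cond_number (H0 n d m x (fst p)) * real K * real n ^ 2) \<longrightarrow>
          (\<forall>t. pred_err n d m (snd p) x y (fedavg d m N K (snd p) x y S eta_l eta_g (fst p) t)
            \<le> (1 - eta_g * eta_l * lambda_min (H0 n d m x (fst p)) * real K / (2 * real N)) ^ t
              * pred_err n d m (snd p) x y (fst p)))"
        (is "\<exists>E \<in> _. _ E \<and> (\<forall>p\<in>E. ?good p)")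
        by (rule main) (fact facts)+
      then obtain E where E: "E \<in> sets (init_measure d m)" "measure (init_measure d m) E \<ge> 1 - \<delta>"
        and good: "\<forall>p\<in>E. ?good p"
        by (elim bexE conjE) (rule that)
      show ?thesis
        by (rule bexI[OF _ E(1)], rule conjI[OF E(2)], rule ballI, unfold split_beta Let_def, intro impI, elim conjE)
          (rule bspec[OF good, THEN mp, THEN mp, THEN mp, THEN mp]; assumption)
    qed
  qed simp_all
qed

end
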